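(* Let $s\ge 2$, let $n_1<\dots<n_s$ be integers, let $i_1,\dots,i_s$ be positive integers with $r=i_1+\dots+i_s$, and let $E_N=\bigoplus_{k=1}^{s}\mathcal{O}(n_k)^{i_k}$ over $\mathbb{CP}^1$. Put $d_l=n_{l+1}-n_l$ for $1\le l\le s-1$. If $s>2$, the group $\mathrm{Aut}(E_N)$ can be expressed as a semidirect product $$\mathrm{Aut}(E_N)\cong\left(\left(G_1\cdot G_2\cdots G_{s-1}\right)\rtimes \mathrm{N}_N\right)\rtimes \mathrm{D}_N ,$$ where $G_1,\dots,G_{s-1}$ are subgroups of $\mathrm{Aut}(E_N)$ whose product set $G_1\cdot G_2\cdots G_{s-1}$ is a subgroup, and where for each $1\le l\le s-1$ the group $G_l$ is isomorphic to the direct product $$\underbrace{\mathrm{N}^{c}_{\lambda_l,[\Pi_l]}\times\dots\times \mathrm{N}^{c}_{\lambda_l,[\Pi_l]}}_{d_l\text{ times}},$$ the factors corresponding to the restrictions of the elements of $G_l$ to the fibers over $d_l$ different points of $\mathbb{CP}^1$. If $s=2$, there is an isomorphism $$\mathrm{Aut}(E_N)\cong\Big(\underbrace{\mathrm{N}_N\times\dots\times \mathrm{N}_N}_{d_1+1\text{ times}}\Big)\rtimes \mathrm{D}_N .$$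
   Context: Bundle conventions. $N=\mathrm{diag}(n_1 I_{i_1},\dots,n_s I_{i_s})$, and $E_N$ is given by the transition function $g_{01}(z)=z^N$ between the trivializations over the affine charts $\mathbb{C}_0=\mathbb{CP}^1\setminus\{\infty\}$ and $\mathbb{C}_1=\mathbb{CP}^1\setminus\{0\}$. An automorphism of $E_N$ is a pair of holomorphic maps $g_i:\mathbb{C}_i\to \mathrm{GL}(r,\mathbb{C})$, $i=0,1$, with $g_0=z^N g_1 z^{-N}$ on $\mathbb{C}^*$. Equivalently it is a block-lower-triangular matrix polynomial $g_0(z)$ (blocks with respect to $r=i_1+\dots+i_s$), with constant invertible diagonal blocks, and whose $(j,k)$ block for $j>k$ has degree at most $n_j-n_k$. Restriction to the fiber over $z\in\mathbb{C}_0$ (resp. $z=\infty$) means evaluating $g_0$ (resp. $g_1$) there. $\mathrm{N}_N\subset \mathrm{GL}(r,\mathbb{C})$ is the group of block-lower-triangular matrices with identity diagonal blocks, and $\mathrm{D}_N\subset \mathrm{GL}(r,\mathbb{C})$ is the group of invertible block-diagonal matrices, with respect to $r=i_1+\dots+i_s$ (both are realized in $\mathrm{Aut}(E_N)$ by constant matrices). $\mathrm{N}^{c}_{\lambda_l,[\Pi_l]}\subset \mathrm{N}_N$ is the group attached to the partition $\lambda_l: r=i_{l+1}+\dots+i_s+i_1+\dots+i_l$ and to the permutation matrix $\Pi_l$ defined by $\Pi_l e_k=e_{\tau_l(k)}$, where $\tau_l(k)\equiv k+i_1+\dots+i_l \pmod r$, $\tau_l(k)\in\{1,\dots,r\}$.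 In general, for an ordered partition $\mu$ of $r$ and a permutation matrix $\Pi$ with $\Pi e_k=e_{\sigma(k)}$, $\mathrm{N}^{c}_{\mu,[\Pi]}$ is the group of lower triangular unipotent $r\times r$ matrices whose $(j,k)$ entry, $j>k$, vanishes unless $\sigma^{-1}(j)<\sigma^{-1}(k)$ and $\sigma^{-1}(j),\sigma^{-1}(k)$ lie in different partition intervals of $\mu$ (the partition intervals of $\mu: r=p_1+\dots+p_t$ being the sets $\{p_1+\dots+p_{q-1}+1,\dots,p_1+\dots+p_q\}$). Concretely, $\mathrm{N}^{c}_{\lambda_l,[\Pi_l]}$ consists of the matrices $\begin{pmatrix} I&0\\ M&I\end{pmatrix}$ with $M$ an arbitrary $(i_{l+1}+\dots+i_s)\times(i_1+\dots+i_l)$ matrix. *)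

theory Defs
  imports
    "HOL-Analysis.Complex_Analysis_Basics"
    "HOL-Algebra.Product_Groups"
    "HOL-Algebra.Bij"
    "Jordan_Normal_Form.Matrix"
begin

text \<open>
  Matrix rows and columns, and the parts of an ordered partition \<open>\<mu>\<close> of \<open>r = sum_list \<mu>\<close>, are
  numbered from 0. For \<open>j < r\<close>, \<open>part_idx \<mu> j\<close> is the number of the partition interval of \<open>\<mu>\<close>
  that contains \<open>j\<close>.
\<close>

definition part_idx :: "nat list \<Rightarrow> nat \<Rightarrow> nat" where
  "part_idx \<mu> j = (LEAST q. j < sum_list (take (Suc q) \<mu>))"

definition GL :: "nat \<Rightarrow> complex mat monoid" where
  "GL r = units_of (ring_mat TYPE(complex) r ())"

text \<open>The partition \<open>r = i\<^sub>1 + \<dots> + i\<^sub>s\<close> is given by the list \<open>ms\<close>.\<close>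

definition NN :: "nat list \<Rightarrow> complex mat set" where
  "NN ms = {A \<in> carrier (GL (sum_list ms)).
     \<forall>j<sum_list ms. \<forall>k<sum_list ms.
       (part_idx ms j = part_idx ms k \<longrightarrow> A $$ (j, k) = (if j = k then 1 else 0)) \<and>
       (part_idx ms j < part_idx ms k \<longrightarrow> A $$ (j, k) = 0)}"

definition DN :: "nat list \<Rightarrow> complex mat set" where
  "DN ms = {A \<in> carrier (GL (sum_list ms)).
     \<forall>j<sum_list ms. \<forall>k<sum_list ms. part_idx ms j \<noteq> part_idx ms k \<longrightarrow> A $$ (j, k) = 0}"

text \<open>
  A permutation matrix \<open>\<Pi>\<close> is represented by the permutation \<open>\<sigma>\<close> of \<open>{..<r}\<close> with
  \<open>\<Pi> e\<^sub>k = e\<^bsub>\<sigma>(k)\<^esub>\<close>.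
\<close>

definition Nc :: "nat list \<Rightarrow> (nat \<Rightarrow> nat) \<Rightarrow> complex mat set" where
  "Nc \<mu> \<sigma> = {A \<in> carrier (GL (sum_list \<mu>)).
     (\<forall>j<sum_list \<mu>. A $$ (j, j) = 1) \<and>
     (\<forall>j<sum_list \<mu>. \<forall>k<sum_list \<mu>. j < k \<longrightarrow> A $$ (j, k) = 0) \<and>
     (\<forall>j<sum_list \<mu>. \<forall>k<sum_list \<mu>. k < j \<longrightarrow>
        \<not> (inv_into {..<sum_list \<mu>} \<sigma> j < inv_into {..<sum_list \<mu>} \<sigma> k \<and>
           part_idx \<mu> (inv_into {..<sum_list \<mu>} \<sigma> j) \<noteq> part_idx \<mu> (inv_into {..<sum_list \<mu>} \<sigma> k)) \<longrightarrow>
        A $$ (j, k) = 0)}"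

text \<open>The partition \<open>\<lambda>\<^sub>l : r = i\<^bsub>l+1\<^esub> + \<dots> + i\<^sub>s + i\<^sub>1 + \<dots> + i\<^sub>l\<close> is \<open>rotate l ms\<close>.\<close>

definition tau :: "nat list \<Rightarrow> nat \<Rightarrow> nat \<Rightarrow> nat" where
  "tau ms l k = (k + sum_list (take l ms)) mod sum_list ms"

abbreviation Nc_l :: "nat list \<Rightarrow> nat \<Rightarrow> complex mat set" where
  "Nc_l ms l \<equiv> Nc (rotate l ms) (tau ms l)"

text \<open>
  \<open>N\<close> is the diagonal matrix whose \<open>j\<close>-th entry is \<open>N_exp ns ms j\<close>; \<open>ns\<close> lists the distinct
  degrees and \<open>ms\<close> their multiplicities.
\<close>

definition N_exp :: "int list \<Rightarrow> nat list \<Rightarrow> nat \<Rightarrow> int" where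
  "N_exp ns ms j = ns ! part_idx ms j"

definition zpow :: "nat \<Rightarrow> (nat \<Rightarrow> int) \<Rightarrow> complex \<Rightarrow> complex mat" where
  "zpow r N z = mat_diag r (\<lambda>j. z powi N j)"

definition holomorphic_GL :: "nat \<Rightarrow> (complex \<Rightarrow> complex mat) \<Rightarrow> bool" where
  "holomorphic_GL r g \<longleftrightarrow>
     (\<forall>z. g z \<in> carrier (GL r)) \<and>
     (\<forall>j<r. \<forall>k<r. (\<lambda>z. g z $$ (j, k)) holomorphic_on UNIV)"

text \<open>
  The second component of an automorphism, a map on the chart around infinity, is written in
  the coordinate \<open>w = 1 / z\<close>, so that \<open>w = 0\<close> is the point at infinity.
\<close>

type_synonym bundle_aut = "(complex \<Rightarrow> complex mat) \<times> (complex \<Rightarrow> complex mat)"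

definition Aut_E :: "int list \<Rightarrow> nat list \<Rightarrow> bundle_aut monoid" where
  "Aut_E ns ms =
    \<lparr>carrier = {(g0, g1).
        holomorphic_GL (sum_list ms) g0 \<and> holomorphic_GL (sum_list ms) g1 \<and>
        (\<forall>z. z \<noteq> 0 \<longrightarrow>
           g0 z = zpow (sum_list ms) (N_exp ns ms) z * g1 (1 / z)
                  * zpow (sum_list ms) (\<lambda>j. - N_exp ns ms j) z)},
     mult = (\<lambda>(g0, g1) (h0, h1). (\<lambda>z. g0 z * h0 z, \<lambda>w. g1 w * h1 w)),
     one = (\<lambda>z. 1\<^sub>m (sum_list ms), \<lambda>w. 1\<^sub>m (sum_list ms))\<rparr>"

text \<open>
  The automorphism with \<open>g\<^sub>0\<close> constantly equal to the block-lower-triangular matrix \<open>A\<close>. The formula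
  for \<open>g\<^sub>1\<close> is the entrywise form of \<open>z\<^bsup>-N\<^esup> A z\<^bsup>N\<^esup>\<close> with \<open>w = 1 / z\<close>; it is also
  correct at \<open>w = 0\<close>, because \<open>0 powi 0 = 1\<close>, \<open>0 powi e = 0\<close> for \<open>e > 0\<close>, and the entries of \<open>A\<close>
  with negative exponent vanish.
\<close>

definition const_aut :: "int list \<Rightarrow> nat list \<Rightarrow> complex mat \<Rightarrow> bundle_aut" where
  "const_aut ns ms A =
    (\<lambda>z. A,
     \<lambda>w. Matrix.mat (sum_list ms) (sum_list ms)
           (\<lambda>(j, k). w powi (N_exp ns ms j - N_exp ns ms k) * A $$ (j, k)))"

datatype cp1 = Affine complex | Infty

fun fiber_restr :: "cp1 \<Rightarrow> bundle_aut \<Rightarrow> complex mat" where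
  "fiber_restr (Affine z) g = fst g z"
| "fiber_restr Infty g = snd g 0"

text \<open>\<open>d\<^sub>l = n\<^bsub>l+1\<^esub> - n\<^sub>l\<close> for \<open>1 \<le> l \<le> s - 1\<close>, where \<open>n\<^sub>l = ns ! (l - 1)\<close>.\<close>

definition gap :: "int list \<Rightarrow> nat \<Rightarrow> nat" where
  "gap ns l = nat (ns ! l - ns ! (l - 1))"

text \<open>The external semidirect product, for an action \<open>\<phi> \<in> hom H (AutoGroup K)\<close>.\<close>

definition semidirect ::
  "('a, 'c) monoid_scheme \<Rightarrow> ('b, 'd) monoid_scheme \<Rightarrow> ('b \<Rightarrow> 'a \<Rightarrow> 'a) \<Rightarrow> ('a \<times> 'b) monoid" where
  "semidirect K H \<phi> =
    \<lparr>carrier = carrier K \<times> carrier H,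
     mult = (\<lambda>(k, h) (k', h'). (k \<otimes>\<^bsub>K\<^esub> \<phi> h k', h \<otimes>\<^bsub>H\<^esub> h')),
     one = (\<one>\<^bsub>K\<^esub>, \<one>\<^bsub>H\<^esub>)\<rparr>"

definition set_mult_list :: "('a, 'b) monoid_scheme \<Rightarrow> 'a set list \<Rightarrow> 'a set" where
  "set_mult_list G Ss = foldr (set_mult G) Ss {\<one>\<^bsub>G\<^esub>}"

end

theory Submission
  imports Defs "HOL-Complex_Analysis.Cauchy_Integral_Formula" "Jordan_Normal_Form.Determinant"
begin

text \<open>
  By Liouville, the entries of \<open>g\<^sub>0\<close> are polynomials of degree at most \<open>N j - N k\<close>, and the
  determinant is constant. Evaluation at \<open>z = 0\<close> therefore splits \<open>Aut(E\<^sub>N)\<close> as its kernel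
  times the constant invertible block-lower-triangular matrices, which are in turn
  \<open>N\<^sub>N \<rtimes> D\<^sub>N\<close>. In the kernel, the exponents \<open>1, \<dots>, n\<^sub>j - n\<^sub>k\<close> of the
  \<open>(j, k)\<close> block are cut into the intervals from \<open>n\<^sub>l - n\<^sub>k + 1\<close> to \<open>n\<^bsub>l+1\<^esub> - n\<^sub>k\<close>, and the matrices
  \<open>I + M\<^sub>l\<close>, where \<open>M\<^sub>l\<close> maps the blocks up to \<open>l\<close> to the later ones and uses only the \<open>l\<close>-th
  intervals, form the abelian group \<open>G\<^sub>l\<close>. As \<open>M\<^sub>l M\<^sub>m = 0\<close> for \<open>l \<le> m\<close>, the product of the
  \<open>I + M\<^sub>l\<close> in increasing order is \<open>I + M\<^sub>1 + \<dots> + M\<^bsub>s-1\<^esub>\<close>, an arbitrary element of the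
  kernel. By Lagrange interpolation at \<open>d\<^sub>l\<close> nonzero points, \<open>G\<^sub>l\<close> is the product of its fiber
  restrictions. For \<open>s = 2\<close> the unipotent automorphisms are already abelian and their
  coefficients give the direct product.
\<close>

section \<open>Internal semidirect products\<close>

lemma mem_AutoGroupI:
  assumes "f \<in> hom K K" "f \<in> extensional (carrier K)" "bij_betw f (carrier K) (carrier K)"
  shows "f \<in> carrier (AutoGroup K)"
  using assms by (auto simp: AutoGroup_def auto_def Bij_def)

lemma carrier_AutoGroupD:
  assumes "f \<in> carrier (AutoGroup K)"
  shows "f \<in> hom K K" "f \<in> extensional (carrier K)" "bij_betw f (carrier K) (carrier K)"
  using assms by (auto simp: AutoGroup_def auto_def Bij_def)

lemma mult_AutoGroup:
  assumes "f \<in> carrier (AutoGroup K)" "g \<in> carrier (AutoGroup K)"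
  shows "f \<otimes>\<^bsub>AutoGroup K\<^esub> g = compose (carrier K) f g"
  using assms by (auto simp: AutoGroup_def BijGroup_def auto_def)

lemma semidirect_simps [simp]:
  "carrier (semidirect K H \<phi>) = carrier K \<times> carrier H"
  "(k, h) \<otimes>\<^bsub>semidirect K H \<phi>\<^esub> (k', h') = (k \<otimes>\<^bsub>K\<^esub> \<phi> h k', h \<otimes>\<^bsub>H\<^esub> h')"
  "\<one>\<^bsub>semidirect K H \<phi>\<^esub> = (\<one>\<^bsub>K\<^esub>, \<one>\<^bsub>H\<^esub>)"
  by (simp_all add: semidirect_def)

text \<open>Needed because the product formed with N_N serves in turn as the normal factor in the
  product with D_N.\<close>

lemma group_semidirect:
  assumes "group K" "group H" "\<phi> \<in> hom H (AutoGroup K)"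
  shows "group (semidirect K H \<phi>)"
proof -
  interpret K: group K by fact
  interpret H: group H by fact
  have \<phi>: "\<phi> h \<in> carrier (AutoGroup K)" if "h \<in> carrier H" for h
    using that assms(3) by (auto simp: hom_def)
  have cl [simp]: "\<phi> h k \<in> carrier K" if "h \<in> carrier H" "k \<in> carrier K" for h k
    using carrier_AutoGroupD(1)[OF \<phi>] that by (auto simp: hom_def)
  have mult: "\<phi> h (k \<otimes>\<^bsub>K\<^esub> k') = \<phi> h k \<otimes>\<^bsub>K\<^esub> \<phi> h k'"
    if "h \<in> carrier H" "k \<in> carrier K" "k' \<in> carrier K" for h k k'
    using carrier_AutoGroupD(1)[OF \<phi>] that by (auto simp: hom_def)
  have comp: "\<phi> (h \<otimes>\<^bsub>H\<^esub> h') k = \<phi> h (\<phi> h' k)"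
    if "h \<in> carrier H" "h' \<in> carrier H" "k \<in> carrier K" for h h' k
  proof -
    have "\<phi> (h \<otimes>\<^bsub>H\<^esub> h') = compose (carrier K) (\<phi> h) (\<phi> h')"
      using hom_mult[OF assms(3)] that by (simp add: mult_AutoGroup \<phi>)
    with that show ?thesis by (simp add: compose_def)
  qed
  \<comment> \<open>The action of the identity is idempotent by \<open>comp\<close> and injective,
    hence the identity map.\<close>
  have one: "\<phi> \<one>\<^bsub>H\<^esub> k = k" if k: "k \<in> carrier K" for k
  proof -
    have "\<phi> \<one>\<^bsub>H\<^esub> (\<phi> \<one>\<^bsub>H\<^esub> k) = \<phi> \<one>\<^bsub>H\<^esub> k" using comp[of "\<one>\<^bsub>H\<^esub>" "\<one>\<^bsub>H\<^esub>" k] k by simp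
    moreover have "inj_on (\<phi> \<one>\<^bsub>H\<^esub>) (carrier K)"
      using carrier_AutoGroupD(3)[OF \<phi>] by (auto simp: bij_betw_def)
    ultimately show ?thesis using k by (auto dest: inj_onD)
  qed
  show ?thesis
  proof (rule groupI)
    fix x assume "x \<in> carrier (semidirect K H \<phi>)"
    then obtain k h where x: "x = (k, h)" "k \<in> carrier K" "h \<in> carrier H" by auto
    let ?y = "(\<phi> (inv\<^bsub>H\<^esub> h) (inv\<^bsub>K\<^esub> k), inv\<^bsub>H\<^esub> h)"
    have "\<phi> (inv\<^bsub>H\<^esub> h) (inv\<^bsub>K\<^esub> k) \<otimes>\<^bsub>K\<^esub> \<phi> (inv\<^bsub>H\<^esub> h) k = \<one>\<^bsub>K\<^esub>"
      using mult[of "inv\<^bsub>H\<^esub> h" "inv\<^bsub>K\<^esub> k" k] mult[of "inv\<^bsub>H\<^esub> h" "\<one>\<^bsub>K\<^esub>" "\<one>\<^bsub>K\<^esub>"] x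
      by (simp add: K.l_cancel_one')
    then show "\<exists>y\<in>carrier (semidirect K H \<phi>). y \<otimes>\<^bsub>semidirect K H \<phi>\<^esub> x = \<one>\<^bsub>semidirect K H \<phi>\<^esub>"
      using x by (intro bexI[of _ ?y]) auto
  qed (auto simp: mult comp one K.m_assoc H.m_assoc)
qed

lemma isoI_inj_surj:
  assumes "h \<in> hom G H" "inj_on h (carrier G)" "\<And>y. y \<in> carrier H \<Longrightarrow> \<exists>x\<in>carrier G. h x = y"
  shows "h \<in> iso G H"
  using assms hom_carrier[OF assms(1)] unfolding iso_def bij_betw_def by blast

text \<open>Injective homomorphisms replace subgroups, so that the normal factor may itself be an
  external semidirect product. The condition \<open>triv\<close> says that the two images meet
  trivially; surjectivity is left to each application.\<close>

lemma (in group) internal_semidirect: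
  assumes "group K" "group H" and f: "f \<in> hom K G" "inj_on f (carrier K)"
    and g: "g \<in> hom H G" "inj_on g (carrier H)"
    and normalise: "\<And>k h. k \<in> carrier K \<Longrightarrow> h \<in> carrier H \<Longrightarrow> g h \<otimes> f k \<otimes> inv (g h) \<in> f ` carrier K"
    and triv: "\<And>k h. k \<in> carrier K \<Longrightarrow> h \<in> carrier H \<Longrightarrow> f k = g h \<Longrightarrow> g h = \<one>"
  shows "\<exists>\<phi>. \<phi> \<in> hom H (AutoGroup K) \<and> (\<lambda>(k, h). f k \<otimes> g h) \<in> hom (semidirect K H \<phi>) G \<and>
    inj_on (\<lambda>(k, h). f k \<otimes> g h) (carrier K \<times> carrier H)"
proof -
  interpret K: group K by fact
  interpret H: group H by fact
  interpret f: group_hom K G f by unfold_locales fact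
  interpret g: group_hom H G g by unfold_locales fact
  \<comment> \<open>Conjugation by \<open>g h\<close>, pulled back along the injection
    \<open>f\<close>. It is restricted to the carrier because members of \<open>AutoGroup K\<close>
    are extensional.\<close>
  define \<phi> where "\<phi> h = (\<lambda>k\<in>carrier K. inv_into (carrier K) f (g h \<otimes> f k \<otimes> inv (g h)))" for h
  have cl [simp]: "\<phi> h k \<in> carrier K" and f\<phi>: "f (\<phi> h k) = g h \<otimes> f k \<otimes> inv (g h)"
    if "k \<in> carrier K" "h \<in> carrier H" for k h
    using inv_into_into[OF normalise[OF that]] f_inv_into_f[OF normalise[OF that]] that
    by (simp_all add: \<phi>_def)
  have inj: "k = k'" if "f k = f k'" "k \<in> carrier K" "k' \<in> carrier K" for k k'
    using f(2) that by (auto dest: inj_onD)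
  have comp: "\<phi> h (\<phi> h' k) = \<phi> (h \<otimes>\<^bsub>H\<^esub> h') k"
    if "k \<in> carrier K" "h \<in> carrier H" "h' \<in> carrier H" for k h h'
    by (rule inj) (use that in \<open>simp_all add: f\<phi> m_assoc inv_mult_group\<close>)
  have id: "\<phi> \<one>\<^bsub>H\<^esub> k = k" if "k \<in> carrier K" for k
    by (rule inj) (use that in \<open>simp_all add: f\<phi>\<close>)
  have aut: "\<phi> h \<in> carrier (AutoGroup K)" if h: "h \<in> carrier H" for h
  proof (rule mem_AutoGroupI)
    show "\<phi> h \<in> hom K K"
    proof (rule homI)
      fix x y assume xy: "x \<in> carrier K" "y \<in> carrier K"
      have "inv (g h) \<otimes> (g h \<otimes> (f y \<otimes> inv (g h))) = f y \<otimes> inv (g h)"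
        using h xy by (simp add: m_assoc[symmetric])
      then show "\<phi> h (x \<otimes>\<^bsub>K\<^esub> y) = \<phi> h x \<otimes>\<^bsub>K\<^esub> \<phi> h y"
        by (intro inj) (use xy h in \<open>simp_all add: f\<phi> m_assoc\<close>)
    qed (use h in auto)
    show "\<phi> h \<in> extensional (carrier K)" by (simp add: \<phi>_def)
    show "bij_betw (\<phi> h) (carrier K) (carrier K)"
      by (rule bij_betw_byWitness[of _ "\<phi> (inv\<^bsub>H\<^esub> h)"]) (use h in \<open>auto simp: comp id\<close>)
  qed
  have "\<phi> \<in> hom H (AutoGroup K)"
  proof (rule homI)
    fix x y assume "x \<in> carrier H" "y \<in> carrier H"
    then show "\<phi> (x \<otimes>\<^bsub>H\<^esub> y) = \<phi> x \<otimes>\<^bsub>AutoGroup K\<^esub> \<phi> y"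
      by (intro extensionalityI[of _ "carrier K"])
        (auto simp: mult_AutoGroup aut compose_def comp, simp add: \<phi>_def)
  qed (rule aut)
  moreover have "(\<lambda>(k, h). f k \<otimes> g h) \<in> hom (semidirect K H \<phi>) G"
  proof (rule homI)
    fix x y assume "x \<in> carrier (semidirect K H \<phi>)" "y \<in> carrier (semidirect K H \<phi>)"
    then obtain k h k' h' where *: "x = (k, h)" "y = (k', h')" "k \<in> carrier K" "k' \<in> carrier K"
      "h \<in> carrier H" "h' \<in> carrier H" by auto
    then have "inv (g h) \<otimes> (g h \<otimes> g h') = g h'"
      by (simp add: m_assoc[symmetric])
    then show "(\<lambda>(k, h). f k \<otimes> g h) (x \<otimes>\<^bsub>semidirect K H \<phi>\<^esub> y) =
        (\<lambda>(k, h). f k \<otimes> g h) x \<otimes> (\<lambda>(k, h). f k \<otimes> g h) y"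
      using * by (simp add: f\<phi> m_assoc)
  qed auto
  moreover have "inj_on (\<lambda>(k, h). f k \<otimes> g h) (carrier K \<times> carrier H)"
  proof (rule inj_onI, clarsimp)
    fix k h k' h' assume *: "k \<in> carrier K" "h \<in> carrier H" "k' \<in> carrier K" "h' \<in> carrier H"
      and eq: "f k \<otimes> g h = f k' \<otimes> g h'"
    \<comment> \<open>An equality of two products is rearranged into an element lying in both
      images, which \<open>triv\<close> forces to be the identity.\<close>
    have "f (inv\<^bsub>K\<^esub> k' \<otimes>\<^bsub>K\<^esub> k) = inv (f k') \<otimes> (f k \<otimes> g h) \<otimes> inv (g h)"
      using * by (simp add: m_assoc)
    also have "\<dots> = g (h' \<otimes>\<^bsub>H\<^esub> inv\<^bsub>H\<^esub> h)"
      unfolding eq using * by (simp add: m_assoc[symmetric])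
    finally have **: "f (inv\<^bsub>K\<^esub> k' \<otimes>\<^bsub>K\<^esub> k) = g (h' \<otimes>\<^bsub>H\<^esub> inv\<^bsub>H\<^esub> h)" .
    have "g (h' \<otimes>\<^bsub>H\<^esub> inv\<^bsub>H\<^esub> h) = \<one>"
      by (rule triv[OF _ _ **]) (use * in auto)
    then have "g h' = g h" using * by (simp add: inv_solve_right')
    then have "h' = h" using g(2) * by (auto dest: inj_onD)
    with eq * have "f k = f k'" by simp
    with inj * \<open>h' = h\<close> show "k = k' \<and> h = h'" by auto
  qed
  ultimately show ?thesis by blast
qed

section \<open>Invertible matrices, entire functions and interpolation\<close>

text \<open>Turns units into nonvanishing determinants, so that invertibility in all fibers can
  later be read off from one constant.\<close>

lemma carrier_GL: "carrier (GL r) = {A \<in> carrier_mat r r. Determinant.det A \<noteq> 0}"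
proof -
  have "carrier (GL r) \<subseteq> carrier_mat r r"
    by (auto simp: GL_def units_of_carrier Units_def ring_mat_simps)
  then show ?thesis
    unfolding GL_def units_of_carrier by (auto intro: det_non_zero_imp_unit dest: unit_imp_det_non_zero)
qed

lemma mult_GL [simp]: "A \<otimes>\<^bsub>GL r\<^esub> B = A * B"
  by (simp add: GL_def units_of_mult ring_mat_simps)

lemma one_GL [simp]: "\<one>\<^bsub>GL r\<^esub> = 1\<^sub>m r"
  by (simp add: GL_def units_of_one ring_mat_simps)

lemma group_GL: "group (GL r)"
proof -
  interpret ring "ring_mat TYPE(complex) r ()" by (rule ring_mat)
  show ?thesis unfolding GL_def by (rule units_group)
qed

lemma GL_I:
  assumes "A \<in> carrier_mat r r" "B \<in> carrier_mat r r" "A * B = 1\<^sub>m r"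
  shows "A \<in> carrier (GL r)"
proof -
  have "Determinant.det A * Determinant.det B = 1"
    using det_mult[OF assms(1,2)] assms(3) by simp
  with assms(1) show ?thesis by (auto simp: carrier_GL)
qed

lemma GL_carrier_mat: "A \<in> carrier (GL r) \<Longrightarrow> A \<in> carrier_mat r r"
  by (simp add: carrier_GL)

lemma index_mult_mat_sum:
  assumes "A \<in> carrier_mat n n" "B \<in> carrier_mat n n" "j < n" "k < n"
  shows "(A * B) $$ (j, k) = (\<Sum>i<n. A $$ (j, i) * B $$ (i, k))"
  using assms by (simp add: scalar_prod_def lessThan_atLeast0)

text \<open>Write \<open>A = I + X\<close> and \<open>B = I + Y\<close>. By hypothesis every product
  of an entry (j, i) of X and an entry (i, k) of Y has a zero factor, so XY = 0 and AB = I + X + Y.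
  Each passage from matrix products to sums of coefficients rests on this.\<close>

lemma mult_mat_complementary:
  fixes A B :: "'a :: comm_ring_1 mat"
  assumes A: "A \<in> carrier_mat n n" and B: "B \<in> carrier_mat n n"
    and AB: "\<And>i j k. \<lbrakk>i < n; j < n; k < n\<rbrakk> \<Longrightarrow> A $$ (j, i) = 1\<^sub>m n $$ (j, i) \<or> B $$ (i, k) = 1\<^sub>m n $$ (i, k)"
    and jk: "j < n" "k < n"
  shows "(A * B) $$ (j, k) = A $$ (j, k) + B $$ (j, k) - (if j = k then 1 else 0)"
proof -
  let ?d = "\<lambda>j k. if j = k then 1 else 0 :: 'a"
  \<comment> \<open>This is (a - d)(b - d') = 0 expanded, with d and d' the corresponding entries of
    the identity matrix.\<close>
  have "A $$ (j, i) * B $$ (i, k) = A $$ (j, i) * ?d i k + ?d j i * B $$ (i, k) - ?d j i * ?d i k"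
    if "i < n" for i
    using AB[OF that jk] that jk by (auto simp: algebra_simps)
  then have "(\<Sum>i<n. A $$ (j, i) * B $$ (i, k)) =
      (\<Sum>i<n. A $$ (j, i) * ?d i k + ?d j i * B $$ (i, k) - ?d j i * ?d i k)"
    by (intro sum.cong) auto
  also have "\<dots> = A $$ (j, k) + B $$ (j, k) - ?d j k"
    unfolding sum.distrib sum_subtractf using jk
    by (simp add: if_distrib[of "\<lambda>x. _ * x"] if_distrib[of "\<lambda>x. x * _"] cong: if_cong)
  finally show ?thesis by (simp only: index_mult_mat_sum[OF A B jk])
qed

lemma holomorphic_on_det:
  assumes "\<And>z. A z \<in> carrier_mat n n"
    and "\<And>j k. j < n \<Longrightarrow> k < n \<Longrightarrow> (\<lambda>z. A z $$ (j, k)) holomorphic_on S"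
  shows "(\<lambda>z. Determinant.det (A z)) holomorphic_on S"
  unfolding det_def'[OF assms(1)]
  by (intro holomorphic_intros assms(2)) (auto dest: permutes_in_image)

text \<open>The entries are signed minors. Divided by a constant determinant the adjugate is the
  inverse, which is how holomorphy of inverses is obtained.\<close>

lemma holomorphic_on_adj_mat:
  assumes A: "\<And>z. A z \<in> carrier_mat n n"
    and hol: "\<And>j k. j < n \<Longrightarrow> k < n \<Longrightarrow> (\<lambda>z. A z $$ (j, k)) holomorphic_on S"
    and jk: "j < n" "k < n"
  shows "(\<lambda>z. adj_mat (A z) $$ (j, k)) holomorphic_on S"
proof -
  have "adj_mat (A z) $$ (j, k) = (-1) ^ (k + j) * Determinant.det (mat_delete (A z) k j)" for z
    using A[of z] jk by (auto simp: adj_mat_def cofactor_def)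
  moreover have "(\<lambda>z. Determinant.det (mat_delete (A z) k j)) holomorphic_on S"
  proof (rule holomorphic_on_det)
    show "mat_delete (A z) k j \<in> carrier_mat (n - 1) (n - 1)" for z
      using A[of z] by (auto simp: mat_delete_def)
    show "(\<lambda>z. mat_delete (A z) k j $$ (j', k')) holomorphic_on S" if "j' < n - 1" "k' < n - 1" for j' k'
    proof -
      have "mat_delete (A z) k j $$ (j', k') =
          A z $$ (if j' < k then j' else Suc j', if k' < j then k' else Suc k')" for z
        using A[of z] that by (auto simp: mat_delete_def)
      then show ?thesis using that by (auto intro: hol)
    qed
  qed
  ultimately show ?thesis by (auto intro!: holomorphic_intros)
qed

section \<open>Liouville-type statements for entire functions\<close>

lemma entire_eqI:
  fixes f h :: "complex \<Rightarrow> complex"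
  assumes "f holomorphic_on UNIV" "h holomorphic_on UNIV" "\<And>z. z \<noteq> 0 \<Longrightarrow> f z = h z"
  shows "f z = h z"
proof (cases "z = 0")
  case True
  \<comment> \<open>Continuity fills in the origin, about which the hypothesis says nothing.\<close>
  have "isCont f 0" "isCont h 0"
    using assms(1,2) by (auto simp: holomorphic_on_imp_continuous_on continuous_on_eq_continuous_at
        dest!: holomorphic_on_imp_continuous_on)
  then have "f \<midarrow>0\<rightarrow> f 0" "h \<midarrow>0\<rightarrow> h 0" by (simp_all add: isCont_def)
  moreover have "\<forall>\<^sub>F z in at 0. f z = h z"
    using assms(3) by (auto simp: eventually_at_filter)
  ultimately show ?thesis using True by (metis LIM_unique tendsto_cong)
qed (use assms in auto)

text \<open>At infinity \<open>h (1 / z)\<close> tends to \<open>h 0\<close> while a negative power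
  of z tends to 0. So \<open>f\<close> tends to 0 there, and Liouville's theorem applies. In other
  words, a line bundle of negative degree has no nonzero sections.\<close>

lemma entire_growth_neg:
  fixes f h :: "complex \<Rightarrow> complex"
  assumes f: "f holomorphic_on UNIV" and h: "h holomorphic_on UNIV"
    and eq: "\<And>z. z \<noteq> 0 \<Longrightarrow> f z = z powi m * h (1 / z)" and "m < 0"
  shows "f z = 0"
proof (rule Liouville_weak[OF f])
  have "isCont h 0"
    using h by (auto simp: continuous_on_eq_continuous_at dest!: holomorphic_on_imp_continuous_on)
  then have "((\<lambda>z. h (inverse z)) \<longlongrightarrow> h 0) at_infinity"
    by (rule isCont_tendsto_compose) (rule tendsto_inverse_0)
  then have lim: "((\<lambda>z. inverse z ^ nat (- m) * h (inverse z)) \<longlongrightarrow> 0 ^ nat (- m) * h 0) at_infinity"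
    by (intro tendsto_intros tendsto_inverse_0)
  moreover have "\<forall>\<^sub>F z in at_infinity. inverse z ^ nat (- m) * h (inverse z) = f z"
    unfolding eventually_at_infinity
  proof (intro exI[of _ 1] allI impI)
    fix z :: complex assume "1 \<le> norm z"
    then have "z \<noteq> 0" by auto
    then show "inverse z ^ nat (- m) * h (inverse z) = f z"
      using \<open>m < 0\<close> by (simp add: eq power_int_def inverse_eq_divide)
  qed
  ultimately show "(f \<longlongrightarrow> 0) at_infinity"
    using Lim_transform_eventually[OF lim] \<open>m < 0\<close> by (simp add: power_0_left)
qed

text \<open>Boundedness of \<open>h\<close> on the closed unit disc bounds \<open>f\<close> by a
  multiple of \<open>norm z ^ m\<close> outside it. This describes the sections of O(m).\<close>

lemma entire_growth_poly:
  fixes f h :: "complex \<Rightarrow> complex"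
  assumes f: "f holomorphic_on UNIV" and h: "h holomorphic_on UNIV"
    and eq: "\<And>z. z \<noteq> 0 \<Longrightarrow> f z = z ^ m * h (1 / z)"
  shows "\<exists>c. \<forall>z. f z = (\<Sum>e\<le>m. c e * z ^ e)"
proof -
  have "bounded (h ` cball 0 1)"
    using h by (intro compact_imp_bounded compact_continuous_image)
      (auto intro: holomorphic_on_imp_continuous_on holomorphic_on_subset)
  then obtain B where B: "\<And>w. norm w \<le> 1 \<Longrightarrow> norm (h w) \<le> B"
    unfolding bounded_iff by fastforce
  have "norm (f z) \<le> B * norm z ^ m" if "1 \<le> norm z" for z
  proof -
    have "z \<noteq> 0" using that by auto
    with B[of "1 / z"] that show ?thesis
      by (auto simp: eq norm_mult norm_power norm_divide divide_simps mult.commute intro!: mult_left_mono)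
  qed
  from Liouville_polynomial[OF f this] show ?thesis
    by (intro exI[of _ "\<lambda>k. (deriv ^^ k) f 0 / fact k"]) auto
qed

section \<open>Polynomial interpolation\<close>

lemma interpolation_exists:
  fixes x y :: "nat \<Rightarrow> 'a :: field"
  assumes "inj_on x {..<d}"
  shows "\<exists>b. \<forall>i<d. (\<Sum>e<d. b e * x i ^ e) = y i"
proof -
  \<comment> \<open>Bounding the degree by vanishing coefficients also covers \<open>d = 0\<close>,
    where it forces \<open>p = 0\<close>.\<close>
  have "\<exists>p. (\<forall>i<d. poly p (x i) = y i) \<and> (\<forall>e\<ge>d. coeff p e = 0)"
    using assms
  proof (induction d)
    case (Suc d)
    then obtain p where p: "\<forall>i<d. poly p (x i) = y i" "\<forall>e\<ge>d. coeff p e = 0"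
      by (auto simp: inj_on_def)
    \<comment> \<open>Newton's step: \<open>w\<close> vanishes at the earlier nodes but not at
      \<open>x d\<close>, so a multiple of it corrects the value at \<open>x d\<close>
      alone.\<close>
    define w where "w = (\<Prod>i<d. [:- x i, 1:])"
    have w: "poly w (x d) \<noteq> 0"
      using Suc.prems by (auto simp: w_def poly_prod dest: inj_onD[of _ _ d])
    have deg: "degree w \<le> d"
      unfolding w_def by (rule order.trans[OF degree_prod_sum_le]) auto
    let ?p = "p + smult ((y d - poly p (x d)) / poly w (x d)) w"
    have "poly ?p (x i) = y i" if "i < Suc d" for i
      using that w p by (cases "i = d") (auto simp: w_def poly_prod)
    moreover have "coeff ?p e = 0" if "e \<ge> Suc d" for e
      using that p deg by (simp add: coeff_eq_0)
    ultimately show ?case by blast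
  qed (auto intro: exI[of _ 0])
  then obtain p where p: "\<forall>i<d. poly p (x i) = y i" "\<forall>e\<ge>d. coeff p e = 0" by blast
  have "poly p u = (\<Sum>e<d. coeff p e * u ^ e)" for u
    unfolding poly_altdef using p(2)
    by (intro sum.mono_neutral_cong) (auto simp: coeff_eq_0 not_le)
  with p(1) show ?thesis by auto
qed

text \<open>A nonzero polynomial of degree below \<open>d\<close> cannot have the \<open>d\<close>
  distinct roots \<open>x i\<close>.\<close>

lemma interpolation_unique:
  fixes x b :: "nat \<Rightarrow> 'a :: field"
  assumes "inj_on x {..<d}" "\<And>i. i < d \<Longrightarrow> (\<Sum>e<d. b e * x i ^ e) = 0" "e < d"
  shows "b e = 0"
proof (rule ccontr)
  assume "b e \<noteq> 0"
  define p where "p = (\<Sum>e<d. monom (b e) e)"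
  have coeff: "coeff p i = (if i < d then b i else 0)" for i
    by (simp add: p_def coeff_sum)
  with \<open>b e \<noteq> 0\<close> \<open>e < d\<close> have "p \<noteq> 0" by (metis coeff_0)
  have "degree p < d"
    using coeff \<open>e < d\<close> by (intro degree_lessI) auto
  moreover have "x ` {..<d} \<subseteq> {z. poly p z = 0}"
    using assms(2) by (auto simp: p_def poly_sum poly_monom)
  then have "card (x ` {..<d}) \<le> card {z. poly p z = 0}"
    by (intro card_mono poly_roots_finite \<open>p \<noteq> 0\<close>)
  ultimately show False
    using card_poly_roots_bound[OF \<open>p \<noteq> 0\<close>] assms(1) by (simp add: card_image)
qed

section \<open>The automorphism group of a split bundle\<close>

text \<open>Replaces the \<open>LEAST\<close> in \<open>part_idx\<close> by a comparison with the
  cut points of the partition, using that prefix sums are monotone. Later arguments never unfold the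
  minimum.\<close>

lemma part_idx_ge_iff:
  assumes "j < sum_list \<mu>"
  shows "l \<le> part_idx \<mu> j \<longleftrightarrow> sum_list (take l \<mu>) \<le> j"
proof -
  let ?P = "\<lambda>q. j < sum_list (take (Suc q) \<mu>)"
  have ex: "?P (length \<mu>)" using assms by simp
  have mono: "sum_list (take a \<mu>) \<le> sum_list (take b \<mu>)" if "a \<le> b" for a b
  proof -
    have "take b \<mu> = take a \<mu> @ drop a (take b \<mu>)"
      using that by (metis append_take_drop_id min.absorb1 take_take)
    then show ?thesis by (metis le_add1 sum_list_append)
  qed
  show ?thesis
  proof
    assume "l \<le> part_idx \<mu> j"
    show "sum_list (take l \<mu>) \<le> j"
    proof (cases l)
      case (Suc l')
      with \<open>l \<le> part_idx \<mu> j\<close> have "l' < (LEAST q. ?P q)" by (simp add: part_idx_def)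
      from not_less_Least[OF this] show ?thesis using Suc by simp
    qed simp
  next
    assume *: "sum_list (take l \<mu>) \<le> j"
    show "l \<le> part_idx \<mu> j"
    proof (rule ccontr)
      assume "\<not> l \<le> part_idx \<mu> j"
      then have "sum_list (take (Suc (part_idx \<mu> j)) \<mu>) \<le> sum_list (take l \<mu>)"
        by (intro mono) simp
      moreover have "?P (part_idx \<mu> j)"
        unfolding part_idx_def by (rule LeastI[of ?P, OF ex])
      ultimately show False using * by simp
    qed
  qed
qed

section \<open>The split bundle and its endomorphisms\<close>

locale split_bundle =
  fixes s :: nat and ns :: "int list" and ms :: "nat list"
  assumes s_ge_2: "s \<ge> 2" and length_ns: "length ns = s" and sorted_ns: "sorted_wrt (<) ns"
    and length_ms: "length ms = s"
begin

abbreviation "r \<equiv> sum_list ms"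
abbreviation "q \<equiv> part_idx ms"
abbreviation "N \<equiv> N_exp ns ms"
abbreviation "Aut \<equiv> Aut_E ns ms"

lemma q_less: "j < r \<Longrightarrow> q j < s"
  using part_idx_ge_iff[of j ms s] length_ms by (simp add: not_le[symmetric])

lemma ns_mono: "a < b \<Longrightarrow> b < s \<Longrightarrow> ns ! a < ns ! b"
  using sorted_wrt_nth_less[OF sorted_ns] length_ns by simp

lemma ns_less_iff: "a < s \<Longrightarrow> b < s \<Longrightarrow> ns ! a < ns ! b \<longleftrightarrow> a < b"
  using ns_mono[of a b] ns_mono[of b a] by (cases a b rule: linorder_cases) auto

lemma ns_le_iff: "a < s \<Longrightarrow> b < s \<Longrightarrow> ns ! a \<le> ns ! b \<longleftrightarrow> a \<le> b"
  using ns_less_iff[of b a] by (auto simp: not_less[symmetric])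

lemma N_less_iff: "j < r \<Longrightarrow> k < r \<Longrightarrow> N j < N k \<longleftrightarrow> q j < q k"
  by (simp add: N_exp_def ns_less_iff q_less)

lemma N_eq_iff: "j < r \<Longrightarrow> k < r \<Longrightarrow> N j = N k \<longleftrightarrow> q j = q k"
  using N_less_iff[of j k] N_less_iff[of k j] by (cases "q j" "q k" rule: linorder_cases) (auto simp: N_exp_def)

text \<open>Automorphisms without the invertibility condition. Conjugation by z^N multiplies the (j,
  k) entry by \<open>z powi (N j - N k)\<close>, so each entry can be treated as a section of a line
  bundle.\<close>

definition End_E :: "bundle_aut set" where
  "End_E = {g. (\<forall>z. fst g z \<in> carrier_mat r r \<and> snd g z \<in> carrier_mat r r) \<and>
     (\<forall>j<r. \<forall>k<r. (\<lambda>z. fst g z $$ (j, k)) holomorphic_on UNIV \<and>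
        (\<lambda>z. snd g z $$ (j, k)) holomorphic_on UNIV \<and>
        (\<forall>z. z \<noteq> 0 \<longrightarrow> fst g z $$ (j, k) = z powi (N j - N k) * snd g (1 / z) $$ (j, k)))}"

lemma End_E_I:
  assumes "\<And>z. fst g z \<in> carrier_mat r r" "\<And>w. snd g w \<in> carrier_mat r r"
    and "\<And>j k. j < r \<Longrightarrow> k < r \<Longrightarrow> (\<lambda>z. fst g z $$ (j, k)) holomorphic_on UNIV"
    and "\<And>j k. j < r \<Longrightarrow> k < r \<Longrightarrow> (\<lambda>w. snd g w $$ (j, k)) holomorphic_on UNIV"
    and "\<And>j k z. j < r \<Longrightarrow> k < r \<Longrightarrow> z \<noteq> 0 \<Longrightarrow>
      fst g z $$ (j, k) = z powi (N j - N k) * snd g (1 / z) $$ (j, k)"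
  shows "g \<in> End_E"
  using assms by (auto simp: End_E_def)

lemma End_E_D:
  assumes "g \<in> End_E"
  shows "fst g z \<in> carrier_mat r r" "snd g w \<in> carrier_mat r r"
    and "j < r \<Longrightarrow> k < r \<Longrightarrow> (\<lambda>z. fst g z $$ (j, k)) holomorphic_on UNIV"
    and "j < r \<Longrightarrow> k < r \<Longrightarrow> (\<lambda>w. snd g w $$ (j, k)) holomorphic_on UNIV"
    and "j < r \<Longrightarrow> k < r \<Longrightarrow> z \<noteq> 0 \<Longrightarrow>
      fst g z $$ (j, k) = z powi (N j - N k) * snd g (1 / z) $$ (j, k)"
  using assms by (auto simp: End_E_def)

lemma transition_index:
  assumes "A \<in> carrier_mat r r" "j < r" "k < r" "z \<noteq> 0"
  shows "(zpow r N z * A * zpow r (\<lambda>j. - N j) z) $$ (j, k) = z powi (N j - N k) * A $$ (j, k)"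
proof -
  have "zpow r N z * A = Matrix.mat r r (\<lambda>(i, j). z powi N i * A $$ (i, j))"
    unfolding zpow_def by (rule mat_diag_mult_left[OF assms(1)])
  then have "zpow r N z * A * zpow r (\<lambda>j. - N j) z =
      Matrix.mat r r (\<lambda>(i, j). Matrix.mat r r (\<lambda>(i, j). z powi N i * A $$ (i, j)) $$ (i, j) * z powi (- N j))"
    unfolding zpow_def by (simp add: mat_diag_mult_right[of _ r r])
  then show ?thesis
    using assms by (simp add: power_int_diff power_int_minus divide_inverse)
qed

lemma transition_eq_iff:
  assumes "A \<in> carrier_mat r r" "B \<in> carrier_mat r r" "z \<noteq> 0"
  shows "B = zpow r N z * A * zpow r (\<lambda>j. - N j) z \<longleftrightarrow>
    (\<forall>j<r. \<forall>k<r. B $$ (j, k) = z powi (N j - N k) * A $$ (j, k))"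
proof -
  have *: "zpow r N z * A * zpow r (\<lambda>j. - N j) z \<in> carrier_mat r r"
    by (auto simp: zpow_def mat_diag_def)
  show ?thesis
    using eq_matI[of "zpow r N z * A * zpow r (\<lambda>j. - N j) z" B] transition_index[OF assms(1) _ _ assms(3)]
      carrier_matD[OF *] carrier_matD[OF assms(2)]
    by metis
qed

text \<open>The two diagonal factors are inverse to each other, so their determinants
  cancel.\<close>

lemma det_transition:
  assumes "A \<in> carrier_mat r r" "z \<noteq> 0"
  shows "Determinant.det (zpow r N z * A * zpow r (\<lambda>j. - N j) z) = Determinant.det A"
proof -
  let ?T = "zpow r N z" and ?T' = "zpow r (\<lambda>j. - N j) z"
  have car: "?T \<in> carrier_mat r r" "?T' \<in> carrier_mat r r"
    by (auto simp: zpow_def mat_diag_def)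
  have "?T * ?T' = mat_diag r (\<lambda>i. z powi N i * z powi - N i)"
    unfolding zpow_def by simp
  also have "\<dots> = 1\<^sub>m r"
    using assms(2) by (simp add: power_int_minus)
  finally have "Determinant.det ?T * Determinant.det ?T' = 1"
    using det_mult[OF car] by simp
  moreover have "Determinant.det (?T * A * ?T') = Determinant.det ?T * Determinant.det A * Determinant.det ?T'"
    using det_mult[of "?T * A" r ?T'] det_mult[OF car(1) assms(1)] car assms(1) by simp
  ultimately show ?thesis by (simp add: mult.commute mult.left_commute)
qed

text \<open>The determinant is an entire function on both charts, hence constant.\<close>

lemma End_E_det:
  assumes g: "g \<in> End_E"
  shows "Determinant.det (fst g z) = Determinant.det (fst g 0)"
    and "Determinant.det (snd g w) = Determinant.det (fst g 0)"
proof -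
  let ?f = "\<lambda>z. Determinant.det (fst g z)" and ?h = "\<lambda>w. Determinant.det (snd g w)"
  have hol: "?f holomorphic_on UNIV" "?h holomorphic_on UNIV"
    by (rule holomorphic_on_det End_E_D[OF g]; assumption?)+
  have eq: "?f z = ?h (1 / z)" if "z \<noteq> 0" for z
  proof -
    have "fst g z = zpow r N z * snd g (1 / z) * zpow r (\<lambda>j. - N j) z"
      using that by (subst transition_eq_iff) (auto simp: End_E_D[OF g])
    then show ?thesis using det_transition[OF End_E_D(2)[OF g] that] by simp
  qed
  \<comment> \<open>The growth statement with exponent 0, which leaves only a constant term.\<close>
  have "\<exists>c. \<forall>z. ?f z = (\<Sum>e\<le>0. c e * z ^ e)"
    by (rule entire_growth_poly[OF hol]) (simp add: eq)
  then obtain c :: "nat \<Rightarrow> complex" where c: "\<And>z. ?f z = c 0" by auto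
  then show "?f z = ?f 0" by simp
  show "?h w = ?f 0"
    by (rule entire_eqI) (use hol eq[of "1 / _"] c in auto)
qed

text \<open>The determinant has the same constant value in both charts, so invertibility at every
  point becomes one condition at the origin.\<close>

lemma mem_Aut_iff: "g \<in> carrier Aut \<longleftrightarrow> g \<in> End_E \<and> Determinant.det (fst g 0) \<noteq> 0"
proof -
  have "g \<in> carrier Aut \<longleftrightarrow> g \<in> End_E \<and> (\<forall>z. Determinant.det (fst g z) \<noteq> 0 \<and> Determinant.det (snd g z) \<noteq> 0)"
    by (cases g) (auto simp: Aut_E_def End_E_def holomorphic_GL_def carrier_GL transition_eq_iff)
  then show ?thesis using End_E_det by metis
qed

lemma Aut_End_E: "g \<in> carrier Aut \<Longrightarrow> g \<in> End_E"
  by (simp add: mem_Aut_iff)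

lemma fst_mult_Aut [simp]: "fst (g \<otimes>\<^bsub>Aut\<^esub> h) z = fst g z * fst h z"
  and snd_mult_Aut [simp]: "snd (g \<otimes>\<^bsub>Aut\<^esub> h) z = snd g z * snd h z"
  and fst_one_Aut [simp]: "fst \<one>\<^bsub>Aut\<^esub> z = 1\<^sub>m r"
  and snd_one_Aut [simp]: "snd \<one>\<^bsub>Aut\<^esub> z = 1\<^sub>m r"
  by (simp_all add: Aut_E_def split: prod.splits)

text \<open>The transition condition determines the second component away from \<open>w = 0\<close>,
  and continuity determines it there. Identities between endomorphisms can therefore be checked in
  the affine chart alone.\<close>

lemma End_E_eqI:
  assumes g: "g \<in> End_E" and h: "h \<in> End_E" and eq: "\<And>z. fst g z = fst h z"
  shows "g = h"
proof (rule prod_eqI)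
  show "snd g = snd h"
  proof
    fix w
    show "snd g w = snd h w"
    proof (rule eq_matI)
      fix j k assume "j < dim_row (snd h w)" "k < dim_col (snd h w)"
      then have jk: "j < r" "k < r" using End_E_D(2)[OF h, of w] by auto
      show "snd g w $$ (j, k) = snd h w $$ (j, k)"
      proof (rule entire_eqI[OF End_E_D(4)[OF g jk] End_E_D(4)[OF h jk]])
        fix w :: complex assume "w \<noteq> 0"
        then show "snd g w $$ (j, k) = snd h w $$ (j, k)"
          using End_E_D(5)[OF g jk, of "1 / w"] End_E_D(5)[OF h jk, of "1 / w"] eq[of "1 / w"] by simp
      qed
    qed (use End_E_D(2)[OF g, of w] End_E_D(2)[OF h, of w] in auto)
  qed
qed (use eq in auto)

text \<open>Conjugation by z^N is multiplicative; in entries, the exponents telescope through the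
  middle index.\<close>

lemma mult_twist:
  fixes A B A' B' :: "complex mat"
  assumes "A \<in> carrier_mat r r" "B \<in> carrier_mat r r" "A' \<in> carrier_mat r r" "B' \<in> carrier_mat r r"
    and "\<And>j k. j < r \<Longrightarrow> k < r \<Longrightarrow> A $$ (j, k) = z powi (N j - N k) * A' $$ (j, k)"
    and "\<And>j k. j < r \<Longrightarrow> k < r \<Longrightarrow> B $$ (j, k) = z powi (N j - N k) * B' $$ (j, k)"
    and "j < r" "k < r" "z \<noteq> 0"
  shows "(A * B) $$ (j, k) = z powi (N j - N k) * (A' * B') $$ (j, k)"
proof -
  have "A $$ (j, i) * B $$ (i, k) = z powi (N j - N k) * (A' $$ (j, i) * B' $$ (i, k))" if "i < r" for i
  proof -
    have "z powi (N j - N k) = z powi (N j - N i) * z powi (N i - N k)"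
      using \<open>z \<noteq> 0\<close> power_int_add[of z "N j - N i" "N i - N k"] by simp
    then show ?thesis using assms that by (simp add: mult.assoc mult.left_commute)
  qed
  then show ?thesis
    unfolding index_mult_mat_sum[OF assms(1,2,7,8)] index_mult_mat_sum[OF assms(3,4,7,8)] sum_distrib_left
    by (intro sum.cong) auto
qed

lemma End_E_mult:
  assumes g: "g \<in> End_E" and h: "h \<in> End_E"
  shows "g \<otimes>\<^bsub>Aut\<^esub> h \<in> End_E"
proof (rule End_E_I)
  show "fst (g \<otimes>\<^bsub>Aut\<^esub> h) z \<in> carrier_mat r r" "snd (g \<otimes>\<^bsub>Aut\<^esub> h) z \<in> carrier_mat r r" for z
    using mult_carrier_mat[OF End_E_D(1)[OF g] End_E_D(1)[OF h]]
      mult_carrier_mat[OF End_E_D(2)[OF g] End_E_D(2)[OF h]] by simp_all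
  fix j k assume jk: "j < r" "k < r"
  show "(\<lambda>z. fst (g \<otimes>\<^bsub>Aut\<^esub> h) z $$ (j, k)) holomorphic_on UNIV"
    unfolding fst_mult_Aut index_mult_mat_sum[OF End_E_D(1)[OF g] End_E_D(1)[OF h] jk]
    by (intro holomorphic_intros End_E_D(3)[OF g] End_E_D(3)[OF h]) (use jk in auto)
  show "(\<lambda>z. snd (g \<otimes>\<^bsub>Aut\<^esub> h) z $$ (j, k)) holomorphic_on UNIV"
    unfolding snd_mult_Aut index_mult_mat_sum[OF End_E_D(2)[OF g] End_E_D(2)[OF h] jk]
    by (intro holomorphic_intros End_E_D(4)[OF g] End_E_D(4)[OF h]) (use jk in auto)
  fix z :: complex assume "z \<noteq> 0"
  then show "fst (g \<otimes>\<^bsub>Aut\<^esub> h) z $$ (j, k) = z powi (N j - N k) * snd (g \<otimes>\<^bsub>Aut\<^esub> h) (1 / z) $$ (j, k)"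
    unfolding fst_mult_Aut snd_mult_Aut
    by (intro mult_twist End_E_D[OF g] End_E_D[OF h] jk)
qed

text \<open>The inverse is the adjugate divided by the determinant, a nonzero constant, so it is
  holomorphic in both charts.\<close>

lemma End_E_inverse:
  assumes g: "g \<in> End_E" and det: "Determinant.det (fst g 0) \<noteq> 0"
  shows "\<exists>h\<in>End_E. h \<otimes>\<^bsub>Aut\<^esub> g = \<one>\<^bsub>Aut\<^esub>"
proof -
  define d where "d = Determinant.det (fst g 0)"
  define h :: bundle_aut where
    "h = (\<lambda>z. (1 / d) \<cdot>\<^sub>m adj_mat (fst g z), \<lambda>w. (1 / d) \<cdot>\<^sub>m adj_mat (snd g w))"
  have [simp]: "d \<noteq> 0" using det by (simp add: d_def)
  note car = End_E_D(1,2)[OF g]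
  have adj: "adj_mat (fst g z) \<in> carrier_mat r r" "adj_mat (snd g z) \<in> carrier_mat r r" for z
    using adj_mat(1) car by blast+
  then have hcar: "fst h z \<in> carrier_mat r r" "snd h z \<in> carrier_mat r r" for z
    by (auto simp: h_def)
  have scale: "(1 / d) \<cdot>\<^sub>m (d \<cdot>\<^sub>m 1\<^sub>m r) = 1\<^sub>m r"
    by (rule eq_matI) auto
  have gh: "fst h z * fst g z = 1\<^sub>m r" "snd g z * snd h z = 1\<^sub>m r" "snd h z * snd g z = 1\<^sub>m r" for z
    using adj_mat(2,3)[OF car(1), of z] adj_mat(2,3)[OF car(2), of z] car[of z] adj[of z] End_E_det[OF g, of z]
    by (auto simp: h_def d_def[symmetric] mult_smult_distrib[of _ r r] mult_smult_assoc_mat[of _ r r] scale)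
  have "h \<in> End_E"
  proof (rule End_E_I)
    fix j k assume jk: "j < r" "k < r"
    have "(\<lambda>z. 1 / d * adj_mat (fst g z) $$ (j, k)) holomorphic_on UNIV"
      by (intro holomorphic_intros holomorphic_on_adj_mat[of _ r] car End_E_D(3)[OF g] jk)
    then show "(\<lambda>z. fst h z $$ (j, k)) holomorphic_on UNIV"
      using jk by (simp add: h_def carrier_matD[OF adj(1)])
    have "(\<lambda>z. 1 / d * adj_mat (snd g z) $$ (j, k)) holomorphic_on UNIV"
      by (intro holomorphic_intros holomorphic_on_adj_mat[of _ r] car End_E_D(4)[OF g] jk)
    then show "(\<lambda>z. snd h z $$ (j, k)) holomorphic_on UNIV"
      using jk by (simp add: h_def carrier_matD[OF adj(2)])
    fix z :: complex assume z: "z \<noteq> 0"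
    \<comment> \<open>\<open>X\<close> is the second component of \<open>h\<close> carried across
      the transition. It is a right inverse of \<open>fst g z\<close>, hence equal to the left
      inverse \<open>fst h z\<close>, and this is the transition condition for
      \<open>h\<close>.\<close>
    define X where "X = Matrix.mat r r (\<lambda>(j, k). z powi (N j - N k) * snd h (1 / z) $$ (j, k))"
    have X: "X \<in> carrier_mat r r" by (simp add: X_def)
    have "fst g z * X = 1\<^sub>m r"
    proof (rule eq_matI)
      fix j k assume "j < dim_row (1\<^sub>m r :: complex mat)" "k < dim_col (1\<^sub>m r :: complex mat)"
      then have jk: "j < r" "k < r" by auto
      have "(fst g z * X) $$ (j, k) = z powi (N j - N k) * (snd g (1 / z) * snd h (1 / z)) $$ (j, k)"
        by (intro mult_twist car hcar X jk z End_E_D(5)[OF g]) (simp_all add: X_def)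
      then show "(fst g z * X) $$ (j, k) = 1\<^sub>m r $$ (j, k)"
        using jk by (simp add: gh del: index_mult_mat)
    qed (use X car in auto)
    then have "fst h z = fst h z * (fst g z * X)"
      using right_mult_one_mat[OF hcar(1), of z] by simp
    also have "\<dots> = X"
      using X by (simp add: gh flip: assoc_mult_mat[OF hcar(1) car(1) X])
    finally show "fst h z $$ (j, k) = z powi (N j - N k) * snd h (1 / z) $$ (j, k)"
      using jk by (simp add: X_def)
  qed (use hcar in auto)
  moreover have "h \<otimes>\<^bsub>Aut\<^esub> g = \<one>\<^bsub>Aut\<^esub>"
    by (rule prod_eqI) (auto simp: fun_eq_iff gh)
  ultimately show ?thesis by blast
qed

lemma one_End_E: "\<one>\<^bsub>Aut\<^esub> \<in> End_E"
  by (rule End_E_I) (auto intro!: holomorphic_intros)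

lemma group_Aut: "group Aut"
proof (rule groupI)
  fix g h assume gh: "g \<in> carrier Aut" "h \<in> carrier Aut"
  then show "g \<otimes>\<^bsub>Aut\<^esub> h \<in> carrier Aut"
    using det_mult[OF End_E_D(1)[OF Aut_End_E] End_E_D(1)[OF Aut_End_E], of g h 0]
    by (auto simp: mem_Aut_iff End_E_mult)
next
  fix g h k assume "g \<in> carrier Aut" "h \<in> carrier Aut" "k \<in> carrier Aut"
  note car = this[THEN Aut_End_E, THEN End_E_D(1)] this[THEN Aut_End_E, THEN End_E_D(2)]
  show "g \<otimes>\<^bsub>Aut\<^esub> h \<otimes>\<^bsub>Aut\<^esub> k = g \<otimes>\<^bsub>Aut\<^esub> (h \<otimes>\<^bsub>Aut\<^esub> k)"
    by (rule prod_eqI) (auto simp: fun_eq_iff assoc_mult_mat[OF car(1-3)] assoc_mult_mat[OF car(4-6)])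
next
  show "\<one>\<^bsub>Aut\<^esub> \<in> carrier Aut"
    by (simp add: mem_Aut_iff one_End_E)
  fix g assume g: "g \<in> carrier Aut"
  show "\<one>\<^bsub>Aut\<^esub> \<otimes>\<^bsub>Aut\<^esub> g = g"
    by (rule prod_eqI) (simp_all add: fun_eq_iff left_mult_one_mat[OF End_E_D(1)[OF Aut_End_E[OF g]]]
        left_mult_one_mat[OF End_E_D(2)[OF Aut_End_E[OF g]]])
  obtain h where h: "h \<in> End_E" "h \<otimes>\<^bsub>Aut\<^esub> g = \<one>\<^bsub>Aut\<^esub>"
    using End_E_inverse[of g] g unfolding mem_Aut_iff by blast
  \<comment> \<open>So far the left inverse is only an endomorphism; its invertible value at the
    origin makes it an automorphism.\<close>
  have "fst h 0 * fst g 0 = 1\<^sub>m r"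
    using h(2) by (metis fst_mult_Aut fst_one_Aut)
  then have "fst h 0 \<in> carrier (GL r)"
    using GL_I End_E_D(1)[OF h(1)] End_E_D(1)[OF Aut_End_E[OF g]] by blast
  with h show "\<exists>h\<in>carrier Aut. h \<otimes>\<^bsub>Aut\<^esub> g = \<one>\<^bsub>Aut\<^esub>"
    by (auto simp: mem_Aut_iff carrier_GL)
qed

sublocale Aut: group Aut by (rule group_Aut)

lemma eval_hom: "group_hom Aut (GL r) (\<lambda>g. fst g z)"
  by (intro group_hom.intro group_hom_axioms.intro group_Aut group_GL homI)
    (auto simp: carrier_GL mem_Aut_iff End_E_det(1)[of _ z] End_E_D)

section \<open>Matrix entries as sections of line bundles\<close>

lemma End_E_entry_upper:
  assumes "g \<in> End_E" "j < r" "k < r" "q j < q k"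
  shows "fst g z $$ (j, k) = 0"
proof (rule entire_growth_neg[OF End_E_D(3-5)[OF assms(1-3)]])
  show "N j - N k < 0" using assms N_less_iff by auto
qed auto

lemma End_E_entry_poly:
  assumes "g \<in> End_E" "j < r" "k < r" "q k \<le> q j"
  shows "\<exists>c. \<forall>z. fst g z $$ (j, k) = (\<Sum>e\<le>nat (N j - N k). c e * z ^ e)"
proof (rule entire_growth_poly[OF End_E_D(3,4)[OF assms(1-3)]])
  have "N j - N k \<ge> 0" using assms N_less_iff[of j k] by auto
  then show "fst g z $$ (j, k) = z ^ nat (N j - N k) * snd g (1 / z) $$ (j, k)" if "z \<noteq> 0" for z
    using End_E_D(5)[OF assms(1-3) that] by (simp add: power_int_def)
qed

text \<open>Inside a diagonal block the degree bound is 0.\<close>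

lemma End_E_entry_diag:
  assumes "g \<in> End_E" "j < r" "k < r" "q j = q k"
  shows "fst g z $$ (j, k) = fst g 0 $$ (j, k)"
proof -
  have "N j = N k" using assms by (simp add: N_eq_iff)
  then show ?thesis using End_E_entry_poly[OF assms(1-3)] assms(4) by auto
qed

section \<open>Splitting off the constant automorphisms\<close>

text \<open>These are exactly the values of automorphisms at a point of the affine chart, and their
  constant extensions are again automorphisms.\<close>

definition parabolic :: "complex mat set" where
  "parabolic = {A \<in> carrier (GL r). \<forall>j<r. \<forall>k<r. q j < q k \<longrightarrow> A $$ (j, k) = 0}"

abbreviation "\<iota> \<equiv> const_aut ns ms"
abbreviation "parabolic_group \<equiv> GL r\<lparr>carrier := parabolic\<rparr>"

lemma fst_const_aut [simp]: "fst (\<iota> A) z = A"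
  by (simp add: const_aut_def)

lemma const_aut_End_E:
  assumes A: "A \<in> carrier_mat r r" and upper: "\<And>j k. j < r \<Longrightarrow> k < r \<Longrightarrow> q j < q k \<Longrightarrow> A $$ (j, k) = 0"
  shows "\<iota> A \<in> End_E"
proof (rule End_E_I)
  fix j k assume jk: "j < r" "k < r"
  show "(\<lambda>w. snd (\<iota> A) w $$ (j, k)) holomorphic_on UNIV"
  proof (cases "q j < q k")
    case True
    with upper jk show ?thesis by (simp add: const_aut_def)
  next
    case False
    \<comment> \<open>A nonnegative exponent turns \<open>powi\<close> into an ordinary power,
      holomorphic at \<open>w = 0\<close> too.\<close>
    then have "N j - N k \<ge> 0" using jk N_less_iff[of j k] by auto
    then show ?thesis using jk by (simp add: const_aut_def power_int_def) (intro holomorphic_intros)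
  qed
  fix z :: complex assume "z \<noteq> 0"
  then have "z powi (N j - N k) * (1 / z) powi (N j - N k) = 1"
    by (simp flip: power_int_mult_distrib)
  then show "fst (\<iota> A) z $$ (j, k) = z powi (N j - N k) * snd (\<iota> A) (1 / z) $$ (j, k)"
    using jk by (simp add: const_aut_def flip: mult.assoc)
qed (use A in \<open>auto simp: const_aut_def\<close>)

lemma parabolic_D:
  assumes "A \<in> parabolic"
  shows "A \<in> carrier (GL r)" "A \<in> carrier_mat r r"
    and "\<And>j k. j < r \<Longrightarrow> k < r \<Longrightarrow> q j < q k \<Longrightarrow> A $$ (j, k) = 0"
  using assms by (auto simp: parabolic_def GL_carrier_mat)

lemma const_aut_closed: "A \<in> parabolic \<Longrightarrow> \<iota> A \<in> carrier Aut"
  using const_aut_End_E[of A] parabolic_D[of A] by (auto simp: mem_Aut_iff carrier_GL)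

lemma fst_parabolic:
  assumes "g \<in> carrier Aut"
  shows "fst g z \<in> parabolic"
  using assms group_hom.hom_closed[OF eval_hom, of g z] End_E_entry_upper[of g]
  by (simp add: parabolic_def Aut_End_E)

text \<open>Evaluation at the origin maps \<open>Aut\<close> onto this set, the constant
  automorphisms being preimages, and the image of a homomorphism is a subgroup.\<close>

lemma subgroup_parabolic: "subgroup parabolic (GL r)"
proof -
  have "parabolic = (\<lambda>g. fst g 0) ` carrier Aut"
    using fst_parabolic const_aut_closed by (force simp: image_iff)
  then show ?thesis using group_hom.img_is_subgroup[OF eval_hom, of 0] by simp
qed

lemma group_parabolic: "group parabolic_group"
  by (rule subgroup.subgroup_is_group[OF subgroup_parabolic group_GL])

lemma const_hom: "group_hom parabolic_group Aut \<iota>"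
proof (intro group_hom.intro group_hom_axioms.intro group_parabolic group_Aut homI)
  fix A B assume "A \<in> carrier parabolic_group" "B \<in> carrier parabolic_group"
  then have AB: "A \<in> parabolic" "B \<in> parabolic" by simp_all
  then have "A * B \<in> parabolic" using subgroup.m_closed[OF subgroup_parabolic] by simp
  then show "\<iota> (A \<otimes>\<^bsub>parabolic_group\<^esub> B) = \<iota> A \<otimes>\<^bsub>Aut\<^esub> \<iota> B"
    using AB by (intro End_E_eqI) (auto intro!: Aut_End_E const_aut_closed End_E_mult)
qed (simp add: const_aut_closed)

lemma const_aut_inj: "\<iota> A = \<iota> B \<Longrightarrow> A = B"
  by (metis fst_const_aut)

section \<open>The Levi decomposition of the parabolic subgroup\<close>

definition block_diag :: "complex mat \<Rightarrow> complex mat" where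
  "block_diag A = Matrix.mat r r (\<lambda>(j, k). if q j = q k then A $$ (j, k) else 0)"

lemma block_diag_carrier [simp]: "block_diag A \<in> carrier_mat r r"
  by (simp add: block_diag_def)

lemma block_diag_one [simp]: "block_diag (1\<^sub>m r) = 1\<^sub>m r"
  by (rule eq_matI) (auto simp: block_diag_def)

text \<open>When \<open>j\<close> and \<open>k\<close> share a block, triangularity kills every term
  of the product whose middle index lies in another block.\<close>

lemma block_diag_mult:
  assumes "A \<in> parabolic" "B \<in> parabolic"
  shows "block_diag (A * B) = block_diag A * block_diag B"
proof (rule eq_matI)
  fix j k assume "j < dim_row (block_diag A * block_diag B)" "k < dim_col (block_diag A * block_diag B)"
  then have jk: "j < r" "k < r" by (auto simp: block_diag_def)
  show "block_diag (A * B) $$ (j, k) = (block_diag A * block_diag B) $$ (j, k)"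
  proof (cases "q j = q k")
    case True
    have "A $$ (j, i) * B $$ (i, k) = block_diag A $$ (j, i) * block_diag B $$ (i, k)" if i: "i < r" for i
      using parabolic_D(3)[OF assms(1) jk(1) i] parabolic_D(3)[OF assms(2) i jk(2)] True jk i
      by (cases "q i" "q j" rule: linorder_cases) (auto simp: block_diag_def)
    moreover have "block_diag (A * B) $$ (j, k) = (A * B) $$ (j, k)"
      using True jk by (simp add: block_diag_def)
    ultimately show ?thesis
      unfolding index_mult_mat_sum[OF block_diag_carrier block_diag_carrier jk]
      by (simp only: index_mult_mat_sum[OF parabolic_D(2)[OF assms(1)] parabolic_D(2)[OF assms(2)] jk]) simp
  next
    case False
    then have "block_diag A $$ (j, i) * block_diag B $$ (i, k) = 0" if "i < r" for i
      using that jk by (auto simp: block_diag_def)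
    then show ?thesis
      unfolding index_mult_mat_sum[OF block_diag_carrier block_diag_carrier jk]
      using False jk by (simp add: sum.neutral) (simp add: block_diag_def)
  qed
qed (auto simp: block_diag_def)

lemma block_diag_hom: "group_hom parabolic_group (GL r) block_diag"
proof (intro group_hom.intro group_hom_axioms.intro group_parabolic group_GL homI)
  interpret parabolic_group: group parabolic_group by (rule group_parabolic)
  fix A assume A: "A \<in> carrier parabolic_group"
  define B where "B = inv\<^bsub>parabolic_group\<^esub> A"
  have "B \<in> parabolic" "A * B = 1\<^sub>m r"
    using parabolic_group.inv_closed[OF A] parabolic_group.r_inv[OF A] by (simp_all add: B_def)
  then have "block_diag A * block_diag B = 1\<^sub>m r"
    using A by (simp flip: block_diag_mult)
  then show "block_diag A \<in> carrier (GL r)"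
    by (intro GL_I[of _ _ "block_diag B"]) auto
qed (simp add: block_diag_mult)

text \<open>D_N is the fixed set of the projection \<open>block_diag\<close>, as N_N will be its
  kernel. Closure and normality then follow from the homomorphism property.\<close>

lemma DN_eq: "DN ms = {A \<in> parabolic. block_diag A = A}"
proof -
  have "block_diag A = A \<longleftrightarrow> (\<forall>j<r. \<forall>k<r. q j \<noteq> q k \<longrightarrow> A $$ (j, k) = 0)" if "A \<in> carrier_mat r r" for A
    using that by (auto simp: mat_eq_iff block_diag_def)
  then show ?thesis
    by (auto simp: DN_def parabolic_def GL_carrier_mat)
qed

lemma NN_eq: "NN ms = {A \<in> parabolic. block_diag A = 1\<^sub>m r}"
proof -
  have "block_diag A = 1\<^sub>m r \<longleftrightarrow> (\<forall>j<r. \<forall>k<r. q j = q k \<longrightarrow> A $$ (j, k) = (if j = k then 1 else 0))"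
    if "A \<in> carrier_mat r r" for A
    using that by (auto simp: mat_eq_iff block_diag_def)
  then show ?thesis
    by (auto simp: NN_def parabolic_def GL_carrier_mat)
qed

lemma block_diag_idem [simp]: "block_diag (block_diag A) = block_diag A"
  by (rule eq_matI) (auto simp: block_diag_def)

lemma block_diag_DN: "A \<in> parabolic \<Longrightarrow> block_diag A \<in> DN ms"
  using group_hom.hom_closed[OF block_diag_hom, of A] by (auto simp: DN_eq parabolic_def block_diag_def)

lemma subgroup_NN: "subgroup (NN ms) parabolic_group"
proof -
  have "NN ms = kernel parabolic_group (GL r) block_diag" by (auto simp: NN_eq kernel_def)
  then show ?thesis using group_hom.subgroup_kernel[OF block_diag_hom] by simp
qed

lemma subgroup_DN: "subgroup (DN ms) parabolic_group"
proof -
  interpret parabolic_group: group parabolic_group by (rule group_parabolic)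
  interpret block_diag: group_hom parabolic_group "GL r" block_diag by (rule block_diag_hom)
  show ?thesis
  proof (rule parabolic_group.subgroupI)
    show "DN ms \<noteq> {}" using block_diag_DN parabolic_group.one_closed by fastforce
    fix A assume A: "A \<in> DN ms"
    then have parabolic: "A \<in> parabolic" "block_diag A = A" by (auto simp: DN_eq)
    have "inv\<^bsub>parabolic_group\<^esub> A \<in> parabolic" using parabolic_group.inv_closed[of A] parabolic by simp
    moreover have "block_diag (inv\<^bsub>parabolic_group\<^esub> A) = inv\<^bsub>parabolic_group\<^esub> A"
      using block_diag.hom_inv[of A] parabolic group.m_inv_consistent[OF group_GL subgroup_parabolic, of A] by simp
    ultimately show "inv\<^bsub>parabolic_group\<^esub> A \<in> DN ms" by (simp add: DN_eq)
  next
    fix A B assume "A \<in> DN ms" "B \<in> DN ms"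
    then show "A \<otimes>\<^bsub>parabolic_group\<^esub> B \<in> DN ms"
      using subgroup.m_closed[OF subgroup_parabolic, of A B] by (simp add: DN_eq block_diag_mult)
  qed (auto simp: DN_eq)
qed

lemma NN_parabolic: "A \<in> NN ms \<Longrightarrow> A \<in> parabolic" and DN_parabolic: "A \<in> DN ms \<Longrightarrow> A \<in> parabolic"
  by (simp_all add: NN_eq DN_eq)

lemma NN_carrier_mat: "A \<in> NN ms \<Longrightarrow> A \<in> carrier_mat r r"
  using NN_parabolic parabolic_D(2) by blast

lemma group_NN: "group (GL r\<lparr>carrier := NN ms\<rparr>)"
  using subgroup.subgroup_is_group[OF subgroup_NN group_parabolic] by simp

lemma group_DN: "group (GL r\<lparr>carrier := DN ms\<rparr>)"
  using subgroup.subgroup_is_group[OF subgroup_DN group_parabolic] by simp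

lemma NN_Int_DN: "A \<in> NN ms \<Longrightarrow> A \<in> DN ms \<Longrightarrow> A = 1\<^sub>m r"
  by (simp add: NN_eq DN_eq)

lemma DN_normalises_NN:
  assumes "A \<in> NN ms" "D \<in> DN ms"
  shows "D \<otimes>\<^bsub>parabolic_group\<^esub> A \<otimes>\<^bsub>parabolic_group\<^esub> inv\<^bsub>parabolic_group\<^esub> D \<in> NN ms"
proof -
  have "kernel parabolic_group (GL r) block_diag = NN ms" by (auto simp: NN_eq kernel_def)
  then have "normal (NN ms) parabolic_group" using group_hom.normal_kernel[OF block_diag_hom] by simp
  from normal.inv_op_closed2[OF this, of D A] show ?thesis
    using assms DN_parabolic by simp
qed

text \<open>As \<open>block_diag\<close> retracts onto D_N with kernel N_N, dividing
  \<open>A\<close> on the right by \<open>block_diag A\<close> leaves an element of N_N.\<close>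

lemma parabolic_factor:
  assumes "A \<in> parabolic"
  shows "\<exists>U\<in>NN ms. \<exists>D\<in>DN ms. A = U * D"
proof -
  interpret parabolic_group: group parabolic_group by (rule group_parabolic)
  define D where "D = block_diag A"
  define U where "U = A \<otimes>\<^bsub>parabolic_group\<^esub> inv\<^bsub>parabolic_group\<^esub> D"
  have D: "D \<in> DN ms" "D \<in> parabolic" using block_diag_DN[OF assms] DN_parabolic by (auto simp: D_def)
  have iD: "inv\<^bsub>parabolic_group\<^esub> D \<in> DN ms" using subgroup.m_inv_closed[OF subgroup_DN D(1)] .
  have "block_diag U = block_diag A * block_diag (inv\<^bsub>parabolic_group\<^esub> D)"
    using assms iD DN_parabolic by (simp add: U_def block_diag_mult)
  also have "\<dots> = D \<otimes>\<^bsub>parabolic_group\<^esub> inv\<^bsub>parabolic_group\<^esub> D"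
    using iD by (simp add: D_def[symmetric] DN_eq)
  also have "\<dots> = 1\<^sub>m r" using parabolic_group.r_inv[of D] D by simp
  finally have "block_diag U = 1\<^sub>m r" .
  moreover have "U \<in> parabolic" using parabolic_group.m_closed[of A "inv\<^bsub>parabolic_group\<^esub> D"] assms iD DN_parabolic by (simp add: U_def)
  ultimately have "U \<in> NN ms" by (simp add: NN_eq)
  moreover have "A \<in> carrier parabolic_group" "D \<in> carrier parabolic_group"
    using assms D by simp_all
  then have "U \<otimes>\<^bsub>parabolic_group\<^esub> D = A"
    using parabolic_group.m_assoc parabolic_group.inv_closed parabolic_group.l_inv parabolic_group.r_one unfolding U_def by metis
  ultimately show ?thesis using D by auto
qed

section \<open>Splitting by evaluation at the origin\<close>

definition Aut_ker :: "bundle_aut set" where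
  "Aut_ker = {g \<in> carrier Aut. fst g 0 = 1\<^sub>m r}"

lemma normal_Aut_ker: "normal Aut_ker Aut"
proof -
  have "kernel Aut (GL r) (\<lambda>g. fst g 0) = Aut_ker" by (auto simp: Aut_ker_def kernel_def)
  then show ?thesis using group_hom.normal_kernel[OF eval_hom, of 0] by simp
qed

lemma subgroup_Aut_ker: "subgroup Aut_ker Aut"
  by (rule normal_imp_subgroup[OF normal_Aut_ker])

text \<open>\<open>internal_semidirect\<close> is applied twice: to the kernel of evaluation and
  N_N, then to their semidirect product and D_N. \<open>Aut_ker\<close> is identified later with the
  product of the G_l.\<close>

lemma Aut_semidirect:
  "\<exists>\<phi> \<psi>. \<phi> \<in> hom (GL r\<lparr>carrier := NN ms\<rparr>) (AutoGroup (Aut\<lparr>carrier := Aut_ker\<rparr>)) \<and>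
     \<psi> \<in> hom (GL r\<lparr>carrier := DN ms\<rparr>)
       (AutoGroup (semidirect (Aut\<lparr>carrier := Aut_ker\<rparr>) (GL r\<lparr>carrier := NN ms\<rparr>) \<phi>)) \<and>
     (\<lambda>((p, A), D). p \<otimes>\<^bsub>Aut\<^esub> \<iota> A \<otimes>\<^bsub>Aut\<^esub> \<iota> D)
       \<in> iso (semidirect (semidirect (Aut\<lparr>carrier := Aut_ker\<rparr>) (GL r\<lparr>carrier := NN ms\<rparr>) \<phi>)
               (GL r\<lparr>carrier := DN ms\<rparr>) \<psi>) Aut"
proof -
  let ?P = "Aut\<lparr>carrier := Aut_ker\<rparr>" and ?N = "GL r\<lparr>carrier := NN ms\<rparr>" and ?D = "GL r\<lparr>carrier := DN ms\<rparr>"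
  interpret c: group_hom parabolic_group Aut \<iota> by (rule const_hom)
  have Aut_ker: "p \<in> carrier Aut" "fst p 0 = 1\<^sub>m r" if "p \<in> Aut_ker" for p
    using that by (auto simp: Aut_ker_def)
  have cN [simp]: "\<iota> A \<in> carrier Aut" if "A \<in> NN ms" for A
    using that const_aut_closed NN_parabolic by blast
  have cD [simp]: "\<iota> A \<in> carrier Aut" if "A \<in> DN ms" for A
    using that const_aut_closed DN_parabolic by blast
  have grpP: "group ?P" by (rule subgroup.subgroup_is_group[OF subgroup_Aut_ker group_Aut])
  have homN: "\<iota> \<in> hom ?N Aut" "\<iota> \<in> hom ?D Aut"
    using c.homh NN_parabolic DN_parabolic by (auto simp: hom_def)
  have one: "\<iota> (1\<^sub>m r) = \<one>\<^bsub>Aut\<^esub>" using c.hom_one by simp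
  have "\<exists>\<phi>. \<phi> \<in> hom ?N (AutoGroup ?P) \<and> (\<lambda>(p, A). p \<otimes>\<^bsub>Aut\<^esub> \<iota> A) \<in> hom (semidirect ?P ?N \<phi>) Aut \<and>
    inj_on (\<lambda>(p, A). p \<otimes>\<^bsub>Aut\<^esub> \<iota> A) (carrier ?P \<times> carrier ?N)"
  proof (rule Aut.internal_semidirect[OF grpP group_NN])
    \<comment> \<open>A constant automorphism in the kernel of evaluation is the identity.\<close>
    fix p A assume "p \<in> carrier ?P" "A \<in> carrier ?N" "p = \<iota> A"
    then have "A = 1\<^sub>m r" using Aut_ker(2)[of p] by simp
    then show "\<iota> A = \<one>\<^bsub>Aut\<^esub>" by (simp add: one)
  qed (use homN Aut_ker normal.inv_op_closed2[OF normal_Aut_ker] in \<open>auto simp: hom_def inj_on_def dest: const_aut_inj\<close>)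
  then obtain \<phi> where \<phi>: "\<phi> \<in> hom ?N (AutoGroup ?P)"
    and hom1: "(\<lambda>(p, A). p \<otimes>\<^bsub>Aut\<^esub> \<iota> A) \<in> hom (semidirect ?P ?N \<phi>) Aut"
    and inj1: "inj_on (\<lambda>(p, A). p \<otimes>\<^bsub>Aut\<^esub> \<iota> A) (carrier ?P \<times> carrier ?N)" by blast
  let ?f = "\<lambda>(p, A). p \<otimes>\<^bsub>Aut\<^esub> \<iota> A"
  have "\<exists>\<psi>. \<psi> \<in> hom ?D (AutoGroup (semidirect ?P ?N \<phi>)) \<and>
      (\<lambda>(k, D). ?f k \<otimes>\<^bsub>Aut\<^esub> \<iota> D) \<in> hom (semidirect (semidirect ?P ?N \<phi>) ?D \<psi>) Aut \<and>
      inj_on (\<lambda>(k, D). ?f k \<otimes>\<^bsub>Aut\<^esub> \<iota> D) (carrier (semidirect ?P ?N \<phi>) \<times> carrier ?D)"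
  proof (rule Aut.internal_semidirect[OF group_semidirect[OF grpP group_NN \<phi>] group_DN hom1 _ homN(2)])
    fix k D assume "k \<in> carrier (semidirect ?P ?N \<phi>)" "D \<in> carrier ?D"
    then obtain p A where k: "k = (p, A)" "p \<in> Aut_ker" "A \<in> NN ms" and D: "D \<in> DN ms" by auto
    \<comment> \<open>Conjugation by \<open>D\<close> acts on the two factors separately:
      \<open>?p\<close> stays in the normal subgroup \<open>Aut_ker\<close> and \<open>?A\<close> in
      N_N.\<close>
    let ?p = "\<iota> D \<otimes>\<^bsub>Aut\<^esub> p \<otimes>\<^bsub>Aut\<^esub> inv\<^bsub>Aut\<^esub> \<iota> D"
    let ?A = "D \<otimes>\<^bsub>parabolic_group\<^esub> A \<otimes>\<^bsub>parabolic_group\<^esub> inv\<^bsub>parabolic_group\<^esub> D"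
    have parabolic: "A \<in> carrier parabolic_group" "D \<in> carrier parabolic_group" using NN_parabolic DN_parabolic k D by auto
    have "\<iota> ?A = \<iota> D \<otimes>\<^bsub>Aut\<^esub> \<iota> A \<otimes>\<^bsub>Aut\<^esub> inv\<^bsub>Aut\<^esub> \<iota> D"
      using parabolic by (simp only: c.hom_mult c.hom_inv c.G.m_closed c.G.inv_closed)
    then have "?p \<otimes>\<^bsub>Aut\<^esub> \<iota> ?A = \<iota> D \<otimes>\<^bsub>Aut\<^esub> (p \<otimes>\<^bsub>Aut\<^esub> \<iota> A) \<otimes>\<^bsub>Aut\<^esub> inv\<^bsub>Aut\<^esub> \<iota> D"
      using k D Aut_ker(1) by (simp add: Aut.m_assoc) (simp flip: Aut.m_assoc)
    moreover have "?p \<in> Aut_ker" using normal.inv_op_closed2[OF normal_Aut_ker] k D by simp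
    ultimately show "\<iota> D \<otimes>\<^bsub>Aut\<^esub> ?f k \<otimes>\<^bsub>Aut\<^esub> inv\<^bsub>Aut\<^esub> \<iota> D \<in> ?f ` carrier (semidirect ?P ?N \<phi>)"
      using DN_normalises_NN[OF k(3) D] k(1) by (auto intro!: image_eqI[of _ _ "(?p, ?A)"])
    assume "?f k = \<iota> D"
    \<comment> \<open>Evaluation at the origin removes \<open>p\<close> and leaves
      \<open>A = D\<close>, an element of both N_N and D_N.\<close>
    then have "fst (?f k) 0 = D" by simp
    then have "D = A" using k Aut_ker(2)[of p] NN_carrier_mat[of A] by simp
    with k D have "D = 1\<^sub>m r" using NN_Int_DN by blast
    then show "\<iota> D = \<one>\<^bsub>Aut\<^esub>" by (simp add: one)
  qed (use inj1 in \<open>auto simp: inj_on_def dest: const_aut_inj\<close>)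
  then obtain \<psi> where \<psi>: "\<psi> \<in> hom ?D (AutoGroup (semidirect ?P ?N \<phi>))"
    and hom2: "(\<lambda>(k, D). ?f k \<otimes>\<^bsub>Aut\<^esub> \<iota> D) \<in> hom (semidirect (semidirect ?P ?N \<phi>) ?D \<psi>) Aut"
    and inj2: "inj_on (\<lambda>(k, D). ?f k \<otimes>\<^bsub>Aut\<^esub> \<iota> D) (carrier (semidirect ?P ?N \<phi>) \<times> carrier ?D)" by blast
  let ?h = "\<lambda>((p, A), D). p \<otimes>\<^bsub>Aut\<^esub> \<iota> A \<otimes>\<^bsub>Aut\<^esub> \<iota> D"
  have h: "(\<lambda>(k, D). ?f k \<otimes>\<^bsub>Aut\<^esub> \<iota> D) = ?h" by auto
  have "\<exists>x\<in>(Aut_ker \<times> NN ms) \<times> DN ms. ?h x = g" if g: "g \<in> carrier Aut" for g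
  proof -
    have B: "fst g 0 \<in> carrier parabolic_group" using fst_parabolic[OF g] by simp
    obtain U D where UD: "U \<in> NN ms" "D \<in> DN ms" "fst g 0 = U * D"
      using parabolic_factor fst_parabolic[OF g] by blast
    let ?c = "\<iota> (fst g 0)"
    have c: "?c \<in> carrier Aut" using const_aut_closed fst_parabolic g by blast
    \<comment> \<open>Dividing out the constant automorphism with the same value at the origin
      leaves the kernel component.\<close>
    let ?p = "g \<otimes>\<^bsub>Aut\<^esub> inv\<^bsub>Aut\<^esub> ?c"
    interpret e: group_hom Aut "GL r" "\<lambda>g. fst g 0" by (rule eval_hom)
    have "fst ?p 0 = fst g 0 \<otimes>\<^bsub>GL r\<^esub> inv\<^bsub>GL r\<^esub> fst g 0"
      using e.hom_inv[OF c] by simp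
    also have "\<dots> = 1\<^sub>m r" using e.H.r_inv[OF e.hom_closed[OF g]] by simp
    finally have p: "?p \<in> Aut_ker" using g c by (simp add: Aut_ker_def)
    have "?c = \<iota> U \<otimes>\<^bsub>Aut\<^esub> \<iota> D"
      using c.hom_mult[of U D] UD NN_parabolic DN_parabolic by simp
    then have "?p \<otimes>\<^bsub>Aut\<^esub> \<iota> U \<otimes>\<^bsub>Aut\<^esub> \<iota> D = ?p \<otimes>\<^bsub>Aut\<^esub> ?c"
      using g c UD by (simp add: Aut.m_assoc)
    also have "\<dots> = g" using g c by (simp add: Aut.m_assoc)
    finally have "?h ((?p, U), D) = g" by simp
    with p UD show ?thesis by (intro bexI[of _ "((?p, U), D)"]) auto
  qed
  moreover have "?h \<in> hom (semidirect (semidirect ?P ?N \<phi>) ?D \<psi>) Aut"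
    "inj_on ?h ((Aut_ker \<times> NN ms) \<times> DN ms)"
    using hom2 inj2 by (simp_all add: h)
  ultimately have "?h \<in> iso (semidirect (semidirect ?P ?N \<phi>) ?D \<psi>) Aut"
    by (intro isoI_inj_surj) auto
  with \<phi> \<psi> show ?thesis by blast
qed

section \<open>Unipotent automorphisms\<close>

text \<open>Here \<open>c j k e\<close> stands for the coefficient of z^e in the (j, k) entry. Sets
  of unipotent automorphisms are described by the monomials that may occur.\<close>

definition supp :: "(nat \<Rightarrow> nat \<Rightarrow> nat \<Rightarrow> complex) \<Rightarrow> (nat \<times> nat \<times> nat) set" where
  "supp c = {(j, k, e). c j k e \<noteq> 0}"

lemma supp_I: "c j k e \<noteq> 0 \<Longrightarrow> (j, k, e) \<in> supp c"
  by (simp add: supp_def)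

lemma supp_zero: "supp c \<subseteq> X \<Longrightarrow> (j, k, e) \<notin> X \<Longrightarrow> c j k e = 0"
  by (auto simp: supp_def)

text \<open>In the coordinate w, the twist by w^m with \<open>m = N j - N k\<close> turns z^e into
  w^(m - e); this gives the second component. For \<open>supp c\<close> inside
  \<open>exponents\<close>, no subtraction is truncated in a nonzero term.\<close>

definition unip_aut :: "(nat \<Rightarrow> nat \<Rightarrow> nat \<Rightarrow> complex) \<Rightarrow> bundle_aut" where
  "unip_aut c =
    (\<lambda>z. Matrix.mat r r (\<lambda>(j, k). (if j = k then 1 else 0) + (\<Sum>e\<le>nat (N j - N k). c j k e * z ^ e)),
     \<lambda>w. Matrix.mat r r (\<lambda>(j, k). (if j = k then 1 else 0) +
           (\<Sum>e\<le>nat (N j - N k). c j k e * w ^ (nat (N j - N k) - e))))"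

definition exponents :: "(nat \<times> nat \<times> nat) set" where
  "exponents = {(j, k, e). j < r \<and> k < r \<and> q k < q j \<and> int e \<le> N j - N k}"

lemma fst_unip_aut_carrier [simp]: "fst (unip_aut c) z \<in> carrier_mat r r"
  and fst_unip_aut_dims [simp]: "dim_row (fst (unip_aut c) z) = r" "dim_col (fst (unip_aut c) z) = r"
  and fst_unip_aut_index [simp]: "j < r \<Longrightarrow> k < r \<Longrightarrow> fst (unip_aut c) z $$ (j, k) =
    (if j = k then 1 else 0) + (\<Sum>e\<le>nat (N j - N k). c j k e * z ^ e)"
  by (simp_all add: unip_aut_def)

lemma fst_unip_aut_0:
  assumes "j < r" "k < r"
  shows "fst (unip_aut c) 0 $$ (j, k) = (if j = k then 1 else 0) + c j k 0"
proof -
  have "(\<Sum>e\<le>n. c j k e * 0 ^ e) = c j k 0" for n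
    by (induction n) auto
  with assms show ?thesis by simp
qed

lemma unip_aut_End_E:
  assumes "supp c \<subseteq> exponents"
  shows "unip_aut c \<in> End_E"
proof (rule End_E_I)
  fix j k assume jk: "j < r" "k < r"
  show "(\<lambda>z. fst (unip_aut c) z $$ (j, k)) holomorphic_on UNIV"
    using jk by (cases "j = k") (auto intro!: holomorphic_intros)
  show "(\<lambda>w. snd (unip_aut c) w $$ (j, k)) holomorphic_on UNIV"
    using jk by (cases "j = k") (auto simp: unip_aut_def intro!: holomorphic_intros)
  fix z :: complex assume z: "z \<noteq> 0"
  let ?m = "nat (N j - N k)"
  show "fst (unip_aut c) z $$ (j, k) = z powi (N j - N k) * snd (unip_aut c) (1 / z) $$ (j, k)"
  proof (cases "q k < q j")
    case True
    then have pos: "N j - N k > 0" using N_less_iff[of k j] jk by simp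
    have "c j k e * z ^ e = z ^ ?m * (c j k e * (1 / z) ^ (?m - e))" if "e \<le> ?m" for e
    proof -
      have "z ^ ?m = z ^ e * z ^ (?m - e)" using that by (simp flip: power_add)
      then show ?thesis using z by (simp add: power_one_over)
    qed
    then have "(\<Sum>e\<le>?m. c j k e * z ^ e) = z ^ ?m * (\<Sum>e\<le>?m. c j k e * (1 / z) ^ (?m - e))"
      unfolding sum_distrib_left by (intro sum.cong) auto
    moreover have "z powi (N j - N k) = z ^ ?m" using pos by (simp add: power_int_def)
    moreover have "j \<noteq> k" using True by auto
    ultimately show ?thesis using jk by (simp add: unip_aut_def)
  next
    case False
    then have "c j k e = 0" for e
      by (intro supp_zero[OF assms]) (auto simp: exponents_def)
    then show ?thesis using jk by (simp add: unip_aut_def)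
  qed
qed (auto simp: unip_aut_def)

lemma unip_aut_zero: "unip_aut (\<lambda>_ _ _. 0) = \<one>\<^bsub>Aut\<^esub>"
  by (rule End_E_eqI[OF unip_aut_End_E one_End_E]) (auto simp: supp_def intro!: eq_matI)

text \<open>The first factor differs from the identity only in columns of blocks numbered below
  \<open>l\<close>, the second only in rows of blocks from \<open>l\<close> on. No middle index
  satisfies both, so the product of the nilpotent parts vanishes.\<close>

lemma unip_aut_mult:
  assumes "supp c \<subseteq> exponents" "supp c' \<subseteq> exponents"
    and c: "\<And>j k e. c j k e \<noteq> 0 \<Longrightarrow> q k < l" and c': "\<And>j k e. c' j k e \<noteq> 0 \<Longrightarrow> l \<le> q j"
  shows "unip_aut c \<otimes>\<^bsub>Aut\<^esub> unip_aut c' = unip_aut (\<lambda>j k e. c j k e + c' j k e)"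
proof (rule End_E_eqI)
  have "supp (\<lambda>j k e. c j k e + c' j k e) \<subseteq> supp c \<union> supp c'" by (auto simp: supp_def)
  then show "unip_aut (\<lambda>j k e. c j k e + c' j k e) \<in> End_E"
    using assms(1,2) by (intro unip_aut_End_E) blast
  fix z
  show "fst (unip_aut c \<otimes>\<^bsub>Aut\<^esub> unip_aut c') z = fst (unip_aut (\<lambda>j k e. c j k e + c' j k e)) z"
  proof (rule eq_matI)
    fix j k
    assume "j < dim_row (fst (unip_aut (\<lambda>j k e. c j k e + c' j k e)) z)"
      "k < dim_col (fst (unip_aut (\<lambda>j k e. c j k e + c' j k e)) z)"
    then have jk: "j < r" "k < r" by auto
    have "(fst (unip_aut c) z * fst (unip_aut c') z) $$ (j, k) =
        fst (unip_aut c) z $$ (j, k) + fst (unip_aut c') z $$ (j, k) - (if j = k then 1 else 0)"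
    proof (rule mult_mat_complementary[of _ r, OF _ _ _ jk])
      fix i j k assume ijk: "i < r" "j < r" "k < r"
      show "fst (unip_aut c) z $$ (j, i) = 1\<^sub>m r $$ (j, i) \<or> fst (unip_aut c') z $$ (i, k) = 1\<^sub>m r $$ (i, k)"
      proof (cases "q i < l")
        case True
        then have "c' i k e = 0" for e using c'[of i k e] by auto
        then show ?thesis using ijk by simp
      next
        case False
        then have "c j i e = 0" for e using c[of j i e] by auto
        then show ?thesis using ijk by simp
      qed
    qed auto
    then show "fst (unip_aut c \<otimes>\<^bsub>Aut\<^esub> unip_aut c') z $$ (j, k) = fst (unip_aut (\<lambda>j k e. c j k e + c' j k e)) z $$ (j, k)"
      using jk by (simp del: index_mult_mat add: sum.distrib distrib_right)
  qed auto
qed (use assms in \<open>auto intro: End_E_mult unip_aut_End_E\<close>)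

text \<open>Diagonal blocks are constant, so the origin decides them; blocks above them vanish, and
  blocks below are polynomials of bounded degree.\<close>

lemma End_E_eq_unip_aut:
  assumes g: "g \<in> End_E"
    and diag: "\<And>j k. j < r \<Longrightarrow> k < r \<Longrightarrow> q j = q k \<Longrightarrow> fst g 0 $$ (j, k) = (if j = k then 1 else 0)"
  shows "\<exists>c. supp c \<subseteq> exponents \<and> g = unip_aut c"
proof -
  have "\<forall>j k. \<exists>c. j < r \<longrightarrow> k < r \<longrightarrow> q k \<le> q j \<longrightarrow>
      (\<forall>z. fst g z $$ (j, k) = (\<Sum>e\<le>nat (N j - N k). c e * z ^ e))"
    using End_E_entry_poly[OF g] by blast
  then obtain C where C: "\<And>j k z. j < r \<Longrightarrow> k < r \<Longrightarrow> q k \<le> q j \<Longrightarrow>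
      fst g z $$ (j, k) = (\<Sum>e\<le>nat (N j - N k). C j k e * z ^ e)" by metis
  \<comment> \<open>\<open>C\<close> is unconstrained outside the admissible positions and degrees,
    so it is set to 0 there.\<close>
  define c where "c j k e = (if (j, k, e) \<in> exponents then C j k e else 0)" for j k e
  have c: "supp c \<subseteq> exponents" by (auto simp: supp_def c_def)
  have "g = unip_aut c"
  proof (rule End_E_eqI[OF g unip_aut_End_E[OF c]], rule eq_matI)
    fix z j k assume "j < dim_row (fst (unip_aut c) z)" "k < dim_col (fst (unip_aut c) z)"
    then have jk: "j < r" "k < r" by auto
    consider "q j < q k" | "q j = q k" | "q k < q j" by linarith
    then show "fst g z $$ (j, k) = fst (unip_aut c) z $$ (j, k)"
    proof cases
      case 1
      then show ?thesis using End_E_entry_upper[OF g jk] jk by (auto simp: c_def exponents_def)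
    next
      case 2
      then show ?thesis using End_E_entry_diag[OF g jk] diag[OF jk] jk by (auto simp: c_def exponents_def)
    next
      case 3
      then have "N j - N k > 0" using N_less_iff[of k j] jk by simp
      then have "c j k e = C j k e" if "e \<le> nat (N j - N k)" for e
        using that jk 3 by (auto simp: c_def exponents_def)
      then have "(\<Sum>e\<le>nat (N j - N k). C j k e * z ^ e) = (\<Sum>e\<le>nat (N j - N k). c j k e * z ^ e)"
        by (intro sum.cong) auto
      with 3 show ?thesis using C[OF jk] jk by auto
    qed
  qed (simp_all add: carrier_matD[OF End_E_D(1)[OF g]])
  with c show ?thesis by blast
qed

section \<open>The kernel of evaluation as a product of abelian groups\<close>

definition pos_exponents :: "(nat \<times> nat \<times> nat) set" where
  "pos_exponents = {(j, k, e) \<in> exponents. e > 0}"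

definition unip_auts :: "(nat \<times> nat \<times> nat) set \<Rightarrow> bundle_aut set" where
  "unip_auts X = unip_aut ` {c. supp c \<subseteq> X}"

text \<open>The value at the origin is the identity plus the matrix of constant coefficients, so the
  kernel condition leaves exactly the positive exponents.\<close>

lemma Aut_ker_eq: "Aut_ker = unip_auts pos_exponents"
proof (intro equalityI subsetI)
  fix g assume "g \<in> Aut_ker"
  then have g: "g \<in> End_E" "fst g 0 = 1\<^sub>m r" by (auto simp: Aut_ker_def Aut_End_E)
  then obtain c where c: "supp c \<subseteq> exponents" "g = unip_aut c"
    using End_E_eq_unip_aut[of g] by auto
  have "c j k 0 = 0" for j k
  proof (cases "j < r \<and> k < r")
    case True
    then have "fst g 0 $$ (j, k) = (if j = k then 1 else 0) + c j k 0"
      unfolding c(2) by (intro fst_unip_aut_0) auto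
    then show ?thesis using True by (simp add: g(2))
  next
    case False
    then show ?thesis by (intro supp_zero[OF c(1)]) (auto simp: exponents_def)
  qed
  then have "(j, k, e) \<in> pos_exponents" if "c j k e \<noteq> 0" for j k e
    using supp_I[of c, OF that] that c(1) by (cases "e = 0") (auto simp: pos_exponents_def)
  then have "supp c \<subseteq> pos_exponents" by (auto simp: supp_def)
  with c(2) show "g \<in> unip_auts pos_exponents" by (auto simp: unip_auts_def)
next
  fix g assume "g \<in> unip_auts pos_exponents"
  then obtain c where c: "supp c \<subseteq> pos_exponents" "g = unip_aut c" by (auto simp: unip_auts_def)
  have "fst g 0 = 1\<^sub>m r"
  proof (rule eq_matI)
    fix j k assume "j < dim_row (1\<^sub>m r :: complex mat)" "k < dim_col (1\<^sub>m r :: complex mat)"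
    moreover have "c j k 0 = 0" by (rule supp_zero[OF c(1)]) (simp add: pos_exponents_def)
    ultimately show "fst g 0 $$ (j, k) = 1\<^sub>m r $$ (j, k)"
      using c(2) by (simp add: fst_unip_aut_0 del: fst_unip_aut_index)
  qed (simp_all add: c(2))
  moreover have "g \<in> End_E" using c by (auto intro!: unip_aut_End_E simp: pos_exponents_def)
  ultimately show "g \<in> Aut_ker" by (simp add: Aut_ker_def mem_Aut_iff)
qed

text \<open>
  The monomials allotted to the factor \<open>G\<^sub>l\<close>. For fixed \<open>(j, k)\<close> the windows of
  \<open>l = q k + 1, \<dots>, q j\<close> tile the exponents \<open>1, \<dots>, N j - N k\<close>, and each has length
  \<open>gap ns l\<close>, which is why \<open>gap ns l\<close> nonzero points determine an element of \<open>G\<^sub>l\<close>.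
\<close>

definition window :: "nat \<Rightarrow> (nat \<times> nat \<times> nat) set" where
  "window l = {(j, k, e). j < r \<and> k < r \<and> q k < l \<and> l \<le> q j \<and>
      ns ! (l - 1) - N k < int e \<and> int e \<le> ns ! l - N k}"

text \<open>As \<open>ns\<close> increases, the lower end of the window is at least 0 and the upper
  end at most \<open>N j - N k\<close>; the strict lower bound makes the exponents positive.\<close>

lemma window_subset:
  assumes "0 < l" "l < s"
  shows "window l \<subseteq> pos_exponents"
proof
  fix x assume "x \<in> window l"
  then obtain j k e where x: "x = (j, k, e)" and *: "j < r" "k < r" "q k < l" "l \<le> q j"
    "ns ! (l - 1) - N k < int e" "int e \<le> ns ! l - N k"
    by (auto simp: window_def)
  have "ns ! q k \<le> ns ! (l - 1)" "ns ! l \<le> ns ! q j"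
    using * assms q_less[of j] by (simp_all add: ns_le_iff)
  with * show "x \<in> pos_exponents" by (auto simp: x pos_exponents_def exponents_def N_exp_def)
qed

lemma pos_exponents_eq: "pos_exponents = (\<Union>l\<in>{1..<s}. window l)"
proof (intro equalityI subsetI)
  fix x assume "x \<in> pos_exponents"
  then obtain j k e where x: "x = (j, k, e)" "j < r" "k < r" "q k < q j" "int e \<le> N j - N k" "e > 0"
    by (auto simp: pos_exponents_def exponents_def)
  let ?P = "\<lambda>l. int e + N k \<le> ns ! l"
  \<comment> \<open>\<open>l\<close> is the first index whose degree reaches \<open>e + N k\<close>.
    Minimality gives the lower bound of the window, and \<open>e > 0\<close> forces
    \<open>q k < l\<close>.\<close>
  define l where "l = (LEAST l. ?P l)"
  have Pj: "?P (q j)" using x by (simp add: N_exp_def)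
  have Pl: "?P l" unfolding l_def by (rule LeastI[of ?P, OF Pj])
  have lj: "l \<le> q j" unfolding l_def by (rule Least_le[of ?P, OF Pj])
  with x(2) q_less have ls: "l < s" by (meson le_less_trans)
  have kl: "q k < l"
  proof (rule ccontr)
    assume "\<not> q k < l"
    then have "ns ! l \<le> N k" using ns_le_iff[of l "q k"] ls q_less[OF x(3)] by (simp add: N_exp_def)
    with Pl x(6) show False by simp
  qed
  then have "\<not> ?P (l - 1)"
    using not_less_Least[of "l - 1" ?P] unfolding l_def[symmetric] by simp
  with Pl lj kl x have "x \<in> window l" by (auto simp: window_def)
  with kl ls show "x \<in> (\<Union>l\<in>{1..<s}. window l)" by (intro UN_I[of l]) auto
next
  fix x assume "x \<in> (\<Union>l\<in>{1..<s}. window l)"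
  then obtain l where "1 \<le> l" "l < s" "x \<in> window l" by auto
  then show "x \<in> pos_exponents" using window_subset[of l] by auto
qed

lemma supp_add: "supp c \<subseteq> X \<Longrightarrow> supp c' \<subseteq> X \<Longrightarrow> supp (\<lambda>j k e. c j k e + c' j k e) \<subseteq> X"
  by (fastforce simp: supp_def)

lemma window_exponents: "0 < l \<Longrightarrow> l < s \<Longrightarrow> window l \<subseteq> exponents"
  using window_subset by (auto simp: pos_exponents_def)

text \<open>Coefficients from window \<open>l\<close> sit in columns with \<open>q k < l\<close>,
  those from later windows in rows with \<open>l \<le> q j\<close>. In this order the factors
  multiply by adding coefficients.\<close>

lemma unip_auts_set_mult:
  assumes "0 < l" "l < s"
  shows "unip_auts (window l) <#>\<^bsub>Aut\<^esub> unip_auts (\<Union>m\<in>{Suc l..<s}. window m) = unip_auts (\<Union>m\<in>{l..<s}. window m)"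
proof -
  let ?U = "\<Union>m\<in>{Suc l..<s}. window m"
  have "{l..<s} = insert l {Suc l..<s}" using assms by auto
  then have eq: "(\<Union>m\<in>{l..<s}. window m) = window l \<union> ?U" by simp
  have mult: "unip_aut c \<otimes>\<^bsub>Aut\<^esub> unip_aut c' = unip_aut (\<lambda>j k e. c j k e + c' j k e)"
    if c: "supp c \<subseteq> window l" and c': "supp c' \<subseteq> ?U" for c c'
  proof (rule unip_aut_mult)
    show "supp c \<subseteq> exponents" using c window_exponents[OF assms] by (rule order.trans)
    have "?U \<subseteq> exponents" by (rule UN_least, rule window_exponents) auto
    with c' show "supp c' \<subseteq> exponents" by (rule order.trans)
    show "q k < l" if "c j k e \<noteq> 0" for j k e
      using supp_I[of c, OF that] c by (auto simp: window_def)
    show "l \<le> q j" if "c' j k e \<noteq> 0" for j k e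
      using supp_I[of c', OF that] c' by (auto simp: window_def)
  qed
  show ?thesis
    unfolding eq
  proof (intro equalityI subsetI)
    fix g assume "g \<in> unip_auts (window l) <#>\<^bsub>Aut\<^esub> unip_auts ?U"
    then obtain c c' where c: "supp c \<subseteq> window l" "supp c' \<subseteq> ?U" "g = unip_aut c \<otimes>\<^bsub>Aut\<^esub> unip_aut c'"
      unfolding set_mult_def unip_auts_def by blast
    then have "supp (\<lambda>j k e. c j k e + c' j k e) \<subseteq> window l \<union> ?U"
      by (intro supp_add) auto
    then show "g \<in> unip_auts (window l \<union> ?U)" unfolding unip_auts_def c(3) mult[OF c(1,2)] by blast
  next
    fix g assume "g \<in> unip_auts (window l \<union> ?U)"
    then obtain c where c: "supp c \<subseteq> window l \<union> ?U" "g = unip_aut c" by (auto simp: unip_auts_def)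
    \<comment> \<open>For the factorisation, the coefficients in window \<open>l\<close> form the
      left factor and all others the right one.\<close>
    define c1 where "c1 j k e = (if (j, k, e) \<in> window l then c j k e else 0)" for j k e
    define c2 where "c2 j k e = (if (j, k, e) \<in> window l then 0 else c j k e)" for j k e
    have 1: "supp c1 \<subseteq> window l" "supp c2 \<subseteq> ?U"
      using c(1) by (auto simp: supp_def c1_def c2_def split: if_splits)
    have "g = unip_aut c1 \<otimes>\<^bsub>Aut\<^esub> unip_aut c2"
      unfolding mult[OF 1] c(2) by (rule arg_cong[of _ _ unip_aut]) (auto simp: fun_eq_iff c1_def c2_def)
    with 1 show "g \<in> unip_auts (window l) <#>\<^bsub>Aut\<^esub> unip_auts ?U"
      unfolding set_mult_def unip_auts_def by blast
  qed
qed

text \<open>Downward induction from \<open>l = s\<close>, where the product is empty and only the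
  zero family is allowed.\<close>

lemma set_mult_list_unip:
  assumes "0 < l" "l \<le> s"
  shows "set_mult_list Aut (map (\<lambda>l. unip_auts (window l)) [l..<s]) = unip_auts (\<Union>m\<in>{l..<s}. window m)"
  using assms(2,1)
proof (induction l rule: inc_induct)
  case base
  have "supp c = {} \<longleftrightarrow> c = (\<lambda>_ _ _. 0)" for c
    by (auto simp: supp_def fun_eq_iff)
  then show ?case by (auto simp: set_mult_list_def unip_auts_def unip_aut_zero)
next
  case (step n)
  have "set_mult_list Aut (map (\<lambda>l. unip_auts (window l)) [n..<s]) =
      unip_auts (window n) <#>\<^bsub>Aut\<^esub> set_mult_list Aut (map (\<lambda>l. unip_auts (window l)) [Suc n..<s])"
    using step.hyps by (simp add: set_mult_list_def upt_conv_Cons)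
  also have "\<dots> = unip_auts (window n) <#>\<^bsub>Aut\<^esub> unip_auts (\<Union>m\<in>{Suc n..<s}. window m)" using step by simp
  also have "\<dots> = unip_auts (\<Union>m\<in>{n..<s}. window m)" using step by (intro unip_auts_set_mult) auto
  finally show ?case .
qed

lemma set_mult_list_G: "set_mult_list Aut (map (\<lambda>l. unip_auts (window l)) [1..<s]) = Aut_ker"
  using set_mult_list_unip[of 1] s_ge_2 by (simp add: Aut_ker_eq pos_exponents_eq)

lemma cut_subgroup_Aut: "0 < l \<Longrightarrow> l < s \<Longrightarrow> unip_auts (window l) \<subseteq> carrier Aut"
  using window_subset[of l] subgroup.subset[OF subgroup_Aut_ker] unfolding Aut_ker_eq unip_auts_def by blast

text \<open>Inside a single window both conditions of \<open>unip_aut_mult\<close> hold for the same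
  \<open>l\<close>, so G_l is an additive group of coefficients.\<close>

lemma cut_subgroup_mult:
  assumes l: "0 < l" "l < s" and "supp c \<subseteq> window l" "supp c' \<subseteq> window l"
  shows "unip_aut c \<otimes>\<^bsub>Aut\<^esub> unip_aut c' = unip_aut (\<lambda>j k e. c j k e + c' j k e)"
proof (rule unip_aut_mult)
  show "supp c \<subseteq> exponents" "supp c' \<subseteq> exponents"
    using assms window_exponents[OF l] by auto
  show "q k < l" if "c j k e \<noteq> 0" for j k e
    using supp_I[of c, OF that] assms by (auto simp: window_def)
  show "l \<le> q j" if "c' j k e \<noteq> 0" for j k e
    using supp_I[of c', OF that] assms by (auto simp: window_def)
qed

lemma subgroup_cut_subgroup:
  assumes l: "0 < l" "l < s"
  shows "subgroup (unip_auts (window l)) Aut"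
proof (rule Aut.subgroupI)
  show "unip_auts (window l) \<subseteq> carrier Aut" by (rule cut_subgroup_Aut[OF l])
  have "supp (\<lambda>_ _ _. 0) \<subseteq> window l" by (auto simp: supp_def)
  then show "unip_auts (window l) \<noteq> {}" by (auto simp: unip_auts_def)
  fix g assume g: "g \<in> unip_auts (window l)"
  then obtain c where c: "supp c \<subseteq> window l" "g = unip_aut c" by (auto simp: unip_auts_def)
  have c': "supp (\<lambda>j k e. - c j k e) \<subseteq> window l" using c(1) by (auto simp: supp_def)
  have "unip_aut (\<lambda>j k e. - c j k e) \<otimes>\<^bsub>Aut\<^esub> g = \<one>\<^bsub>Aut\<^esub>"
    unfolding c(2) cut_subgroup_mult[OF l c' c(1)] by (simp add: unip_aut_zero)
  then have "inv\<^bsub>Aut\<^esub> g = unip_aut (\<lambda>j k e. - c j k e)"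
    using Aut.inv_equality cut_subgroup_Aut[OF l] g c' unfolding unip_auts_def by blast
  with c' show "inv\<^bsub>Aut\<^esub> g \<in> unip_auts (window l)" by (auto simp: unip_auts_def)
next
  fix g h assume "g \<in> unip_auts (window l)" "h \<in> unip_auts (window l)"
  then show "g \<otimes>\<^bsub>Aut\<^esub> h \<in> unip_auts (window l)"
    using cut_subgroup_mult[OF l] supp_add unfolding unip_auts_def by (smt (verit) imageE image_eqI mem_Collect_eq)
qed

section \<open>Restriction to fibers\<close>

text \<open>The concrete form of \<open>Nc_l ms l\<close>: block matrices with rows (I, 0) and (M,
  I), cut after the first \<open>l\<close> blocks.\<close>

definition cut_unipotent :: "nat \<Rightarrow> complex mat set" where
  "cut_unipotent l = {A \<in> carrier (GL r). \<forall>j<r. \<forall>k<r. \<not> (q k < l \<and> l \<le> q j) \<longrightarrow>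
     A $$ (j, k) = (if j = k then 1 else 0)}"

lemma cut_unipotent_carrier_mat: "A \<in> cut_unipotent l \<Longrightarrow> A \<in> carrier_mat r r"
  by (simp add: cut_unipotent_def GL_carrier_mat)

lemma cut_unipotent_trivial:
  "A \<in> cut_unipotent l \<Longrightarrow> j < r \<Longrightarrow> k < r \<Longrightarrow> \<not> (q k < l \<and> l \<le> q j) \<Longrightarrow> A $$ (j, k) = (if j = k then 1 else 0)"
  by (simp add: cut_unipotent_def)

text \<open>Stated without invertibility, since it also serves to prove that such matrices are
  invertible.\<close>

lemma cut_mult_index:
  fixes A B :: "complex mat"
  assumes A: "A \<in> carrier_mat r r" and B: "B \<in> carrier_mat r r"
    and "\<And>j k. j < r \<Longrightarrow> k < r \<Longrightarrow> \<not> (q k < l \<and> l \<le> q j) \<Longrightarrow> A $$ (j, k) = (if j = k then 1 else 0)"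
    and "\<And>j k. j < r \<Longrightarrow> k < r \<Longrightarrow> \<not> (q k < l \<and> l \<le> q j) \<Longrightarrow> B $$ (j, k) = (if j = k then 1 else 0)"
    and jk: "j < r" "k < r"
  shows "(A * B) $$ (j, k) = A $$ (j, k) + B $$ (j, k) - (if j = k then 1 else 0)"
proof (rule mult_mat_complementary[of _ r, OF _ _ _ jk])
  fix i j k assume "i < r" "j < r" "k < r"
  then show "A $$ (j, i) = 1\<^sub>m r $$ (j, i) \<or> B $$ (i, k) = 1\<^sub>m r $$ (i, k)"
    using assms(3)[of j i] assms(4)[of i k] by (cases "q i < l") auto
qed (use A B in auto)

lemma cut_unipotent_mult_index:
  assumes "A \<in> cut_unipotent l" "B \<in> cut_unipotent l" "j < r" "k < r"
  shows "(A * B) $$ (j, k) = A $$ (j, k) + B $$ (j, k) - (if j = k then 1 else 0)"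
  by (rule cut_mult_index[where l = l]) (use assms cut_unipotent_carrier_mat cut_unipotent_trivial in blast)+

lemma mem_cut_unipotent_I:
  assumes A: "A \<in> carrier_mat r r"
    and triv: "\<And>j k. j < r \<Longrightarrow> k < r \<Longrightarrow> \<not> (q k < l \<and> l \<le> q j) \<Longrightarrow> A $$ (j, k) = (if j = k then 1 else 0)"
  shows "A \<in> cut_unipotent l"
proof -
  \<comment> \<open>With \<open>A = I + M\<close> this is \<open>I - M\<close>, the inverse of
    \<open>A\<close> because M squared is 0.\<close>
  define B where "B = Matrix.mat r r (\<lambda>(j, k). if j = k then 1 else - A $$ (j, k))"
  have B: "B \<in> carrier_mat r r" by (simp add: B_def)
  have "A * B = 1\<^sub>m r"
  proof (rule eq_matI)
    fix j k assume "j < dim_row (1\<^sub>m r :: complex mat)" "k < dim_col (1\<^sub>m r :: complex mat)"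
    then have jk: "j < r" "k < r" by auto
    have "(A * B) $$ (j, k) = A $$ (j, k) + B $$ (j, k) - (if j = k then 1 else 0)"
      by (rule cut_mult_index[OF A B _ _ jk, where l = l]) (use triv in \<open>auto simp: B_def\<close>)
    then show "(A * B) $$ (j, k) = 1\<^sub>m r $$ (j, k)"
      using jk triv[of j j] by (auto simp: B_def simp del: index_mult_mat)
  qed (use A B in auto)
  then have "A \<in> carrier (GL r)" using GL_I[OF A B] by simp
  then show ?thesis using triv by (simp add: cut_unipotent_def)
qed

text \<open>The inverse of \<open>tau ms l\<close> interchanges the indices before and after the cut
  and keeps the order within each group. A position below the diagonal is therefore inverted exactly
  when it straddles the cut, and its indices then lie in different parts of the rotated
  partition.\<close>

lemma Nc_l_eq:
  assumes l: "0 < l" "l < s"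
  shows "Nc_l ms l = cut_unipotent l"
proof -
  define t where "t = sum_list (take l ms)"
  have rot: "rotate l ms = drop l ms @ take l ms"
    using l length_ms by (simp add: rotate_drop_take)
  have r: "r = t + sum_list (drop l ms)"
    unfolding t_def by (metis append_take_drop_id sum_list_append)
  then have sum: "sum_list (rotate l ms) = r" by (simp add: rot t_def)
  \<comment> \<open>The first \<open>s - l\<close> parts of \<open>rotate l ms\<close> are the
    entries of \<open>drop l ms\<close>, with sum \<open>r - t\<close>.\<close>
  have part: "s - l \<le> part_idx (rotate l ms) x \<longleftrightarrow> r - t \<le> x" if "x < r" for x
    using part_idx_ge_iff[of x "rotate l ms" "s - l"] that r length_ms l by (simp add: sum) (simp add: rot)
  have cut: "l \<le> q j \<longleftrightarrow> t \<le> j" if "j < r" for j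
    using part_idx_ge_iff[OF that] by (simp add: t_def)
  \<comment> \<open>The explicit inverse of \<open>tau ms l\<close>: subtraction of \<open>t\<close>
    modulo \<open>r\<close>.\<close>
  define u where "u j = (if t \<le> j then j - t else j + r - t)" for j
  have u: "u j < r" "tau ms l (u j) = j" if "j < r" for j
  proof -
    show "u j < r" using that r by (auto simp: u_def)
    have "u j + t = (if t \<le> j then j else j + r)" using r by (simp add: u_def)
    then show "tau ms l (u j) = j" using that by (simp add: tau_def t_def[symmetric])
  qed
  then have "{..<r} \<subseteq> tau ms l ` {..<r}" by (force intro: image_eqI[of _ _ "u _"])
  then have inj: "inj_on (tau ms l) {..<r}" by (intro finite_surj_inj) auto
  have inv: "inv_into {..<r} (tau ms l) j = u j" if "j < r" for j
    using inv_into_f_eq[OF inj, of "u j" j] u[OF that] by simp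
  have cond: "(u j < u k \<and> part_idx (rotate l ms) (u j) \<noteq> part_idx (rotate l ms) (u k)) \<longleftrightarrow>
      (q k < l \<and> l \<le> q j)" if "k < j" "j < r" for j k
  proof -
    have k: "k < r" using that by simp
    show ?thesis
    proof (cases "k < t \<and> t \<le> j")
      case True
      then have "u j < r - t" "r - t \<le> u k" using that r by (auto simp: u_def)
      moreover from this have "u j < u k" by simp
      ultimately show ?thesis
        using part[OF u(1)[OF \<open>j < r\<close>]] part[OF u(1)[OF k]] cut[OF \<open>j < r\<close>] cut[OF k] True by auto
    next
      case False
      then have "\<not> u j < u k" using that r by (auto simp: u_def)
      then show ?thesis using False cut[OF \<open>j < r\<close>] cut[OF k] by auto
    qed
  qed
  have order: "k < j" if "q k < l" "l \<le> q j" "j < r" "k < r" for j k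
    using cut[of j] cut[of k] that by auto
  have "A \<in> Nc_l ms l \<longleftrightarrow> A \<in> cut_unipotent l" for A
  proof -
    have "A \<in> Nc_l ms l \<longleftrightarrow> A \<in> carrier (GL r) \<and> (\<forall>j<r. A $$ (j, j) = 1) \<and>
        (\<forall>j<r. \<forall>k<r. j < k \<longrightarrow> A $$ (j, k) = 0) \<and>
        (\<forall>j<r. \<forall>k<r. k < j \<longrightarrow> \<not> (q k < l \<and> l \<le> q j) \<longrightarrow> A $$ (j, k) = 0)"
      unfolding Nc_def sum by (simp add: inv cond)
    also have "\<dots> \<longleftrightarrow> A \<in> carrier (GL r) \<and> (\<forall>j<r. \<forall>k<r. \<not> (q k < l \<and> l \<le> q j) \<longrightarrow>
        A $$ (j, k) = (if j = k then 1 else 0))" (is "?L \<longleftrightarrow> ?R")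
    proof
      assume L: ?L
      have "A $$ (j, k) = (if j = k then 1 else 0)" if "j < r" "k < r" "\<not> (q k < l \<and> l \<le> q j)" for j k
        using L that by (cases j k rule: linorder_cases) auto
      with L show ?R by blast
    next
      assume R: ?R
      then have *: "A $$ (j, k) = (if j = k then 1 else 0)" if "j < r" "k < r" "\<not> (q k < l \<and> l \<le> q j)" for j k
        using that by blast
      have "A $$ (j, j) = 1" if "j < r" for j using *[OF that that] by auto
      moreover have "A $$ (j, k) = 0" if "j < r" "k < r" "j < k" for j k
        using *[OF that(1,2)] order[of k j] that by force
      moreover have "A $$ (j, k) = 0" if "j < r" "k < r" "k < j" "\<not> (q k < l \<and> l \<le> q j)" for j k
        using *[OF that(1,2,4)] that(3) by simp
      ultimately show ?L using R by blast
    qed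
    also have "\<dots> \<longleftrightarrow> A \<in> cut_unipotent l" by (simp add: cut_unipotent_def)
    finally show ?thesis .
  qed
  then show ?thesis by blast
qed

text \<open>With block numbers 0 and 1 only, the lower left block is the sole free one.\<close>

lemma NN_eq_cut_unipotent:
  assumes "s = 2"
  shows "NN ms = cut_unipotent 1"
proof -
  have q01: "q j = 0 \<or> q j = 1" if "j < r" for j using q_less[OF that] assms by auto
  have "(q j = q k \<longrightarrow> A $$ (j, k) = (if j = k then 1 else 0)) \<and> (q j < q k \<longrightarrow> A $$ (j, k) = 0) \<longleftrightarrow>
      (\<not> (q k < 1 \<and> 1 \<le> q j) \<longrightarrow> A $$ (j, k) = (if j = k then 1 else 0))"
    if "j < r" "k < r" for A :: "complex mat" and j k
    using q01[OF that(1)] q01[OF that(2)] by (elim disjE) auto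
  then show ?thesis
    unfolding NN_def cut_unipotent_def by (intro Collect_cong conj_cong refl all_cong1 imp_cong)
qed

lemma gap_pos: "0 < l \<Longrightarrow> l < s \<Longrightarrow> 0 < gap ns l \<and> int (gap ns l) = ns ! l - ns ! (l - 1)"
  using ns_mono[of "l - 1" l] by (simp add: gap_def)

text \<open>In each entry the window allows \<open>gap ns l\<close> consecutive exponents, starting
  at \<open>Suc a\<close> because its lower bound is strict. Factoring out that power leaves a
  polynomial of degree below \<open>gap ns l\<close>.\<close>

lemma window_sum:
  assumes l: "0 < l" "l < s" and c: "supp c \<subseteq> window l" and jk: "j < r" "k < r" "q k < l" "l \<le> q j"
  defines "a \<equiv> nat (ns ! (l - 1) - N k)"
  shows "(\<Sum>e\<le>nat (N j - N k). c j k e * z ^ e) =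
    z ^ Suc a * (\<Sum>i<gap ns l. c j k (Suc a + i) * z ^ i)"
proof -
  have ord: "N k \<le> ns ! (l - 1)" "ns ! l \<le> N j"
    using jk l q_less[OF jk(1)] q_less[OF jk(2)] by (simp_all add: N_exp_def ns_le_iff)
  note gap = gap_pos[OF l]
  have zero: "c j k e = 0" if "e \<notin> {Suc a..<Suc a + gap ns l}" for e
    by (rule supp_zero[OF c]) (use that ord gap in \<open>auto simp: window_def a_def\<close>)
  have sub: "{Suc a..<Suc a + gap ns l} \<subseteq> {..nat (N j - N k)}"
    using ord gap by (auto simp: a_def)
  have "(\<Sum>e\<le>nat (N j - N k). c j k e * z ^ e) = (\<Sum>e\<in>{Suc a..<Suc a + gap ns l}. c j k e * z ^ e)"
    by (rule sum.mono_neutral_right) (use sub zero in auto)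
  also have "\<dots> = (\<Sum>i<gap ns l. c j k (Suc a + i) * z ^ (Suc a + i))"
    by (subst sum.atLeastLessThan_shift_0) (simp add: lessThan_atLeast0)
  also have "\<dots> = z ^ Suc a * (\<Sum>i<gap ns l. c j k (Suc a + i) * z ^ i)"
    unfolding sum_distrib_left by (intro sum.cong) (simp_all add: power_add mult_ac)
  finally show ?thesis .
qed

text \<open>The points are 1, ..., \<open>gap ns l\<close>. They are nonzero, so the monomial factor
  can be divided out, and distinct, so interpolation recovers the remaining polynomial from its
  values.\<close>

lemma fiber_iso:
  assumes l: "0 < l" "l < s"
  shows "(\<lambda>g. \<lambda>i\<in>{..<gap ns l}. fiber_restr (Affine (of_nat (Suc i))) g)
    \<in> iso (Aut\<lparr>carrier := unip_auts (window l)\<rparr>) (product_group {..<gap ns l} (\<lambda>_. GL r\<lparr>carrier := Nc_l ms l\<rparr>))"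
    (is "?\<Phi> \<in> iso ?G ?H")
proof (rule isoI_inj_surj)
  let ?x = "\<lambda>i. of_nat (Suc i) :: complex"
  have x0: "?x i \<noteq> 0" for i by (simp del: of_nat_Suc)
  have xinj: "inj_on ?x {..<gap ns l}" by (auto simp: inj_on_def)
  have cut_unipotent: "fst (unip_aut c) z \<in> cut_unipotent l" if c: "supp c \<subseteq> window l" for c z
  proof (rule mem_cut_unipotent_I)
    fix j k assume jk: "j < r" "k < r" "\<not> (q k < l \<and> l \<le> q j)"
    then have "c j k e = 0" for e
      by (intro supp_zero[OF c]) (auto simp: window_def)
    then show "fst (unip_aut c) z $$ (j, k) = (if j = k then 1 else 0)" using jk by simp
  qed simp
  show "?\<Phi> \<in> hom ?G ?H"
  proof (rule homI)
    fix g assume "g \<in> carrier ?G"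
    then show "?\<Phi> g \<in> carrier ?H" using cut_unipotent by (auto simp: unip_auts_def Nc_l_eq[OF l])
  next
    fix g h
    show "?\<Phi> (g \<otimes>\<^bsub>?G\<^esub> h) = ?\<Phi> g \<otimes>\<^bsub>?H\<^esub> ?\<Phi> h"
      by (auto simp: fun_eq_iff)
  qed
  show "inj_on ?\<Phi> (carrier ?G)"
  proof (rule inj_onI)
    fix g g' assume "g \<in> carrier ?G" "g' \<in> carrier ?G" and eq: "?\<Phi> g = ?\<Phi> g'"
    then obtain c c' where c: "supp c \<subseteq> window l" "g = unip_aut c" and c': "supp c' \<subseteq> window l" "g' = unip_aut c'"
      by (auto simp: unip_auts_def)
    have fib: "fst g (?x i) = fst g' (?x i)" if "i < gap ns l" for i
      using fun_cong[OF eq, of i] that by simp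
    have "c j k e = c' j k e" for j k e
    proof (cases "(j, k, e) \<in> window l")
      case False
      then show ?thesis using supp_zero[OF c(1)] supp_zero[OF c'(1)] by simp
    next
      case True
      then have jk: "j < r" "k < r" "q k < l" "l \<le> q j" by (auto simp: window_def)
      define a where "a = nat (ns ! (l - 1) - N k)"
      have "N k \<le> ns ! (l - 1)"
        using jk l q_less[OF jk(2)] by (simp add: N_exp_def ns_le_iff)
      then have e: "Suc a \<le> e" "e - Suc a < gap ns l"
        using True gap_pos[OF l] by (auto simp: window_def a_def)
      \<comment> \<open>The difference of the two coefficient runs, reindexed from 0, gives a
        polynomial vanishing at all nodes.\<close>
      have "c j k (Suc a + (e - Suc a)) - c' j k (Suc a + (e - Suc a)) = 0"
      proof (rule interpolation_unique[OF xinj _ e(2), where b = "\<lambda>i. c j k (Suc a + i) - c' j k (Suc a + i)"])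
        fix i assume "i < gap ns l"
        from arg_cong[OF fib[OF this], of "\<lambda>A. A $$ (j, k)"]
        have "?x i ^ Suc a * (\<Sum>e<gap ns l. c j k (Suc a + e) * ?x i ^ e) =
            ?x i ^ Suc a * (\<Sum>e<gap ns l. c' j k (Suc a + e) * ?x i ^ e)"
          unfolding c(2) c'(2) fst_unip_aut_index[OF jk(1,2)] window_sum[OF l c(1) jk] window_sum[OF l c'(1) jk]
            a_def by simp
        then have "(\<Sum>e<gap ns l. c j k (Suc a + e) * ?x i ^ e) = (\<Sum>e<gap ns l. c' j k (Suc a + e) * ?x i ^ e)"
          using x0[of i] by (simp del: of_nat_Suc power_Suc)
        then show "(\<Sum>e<gap ns l. (c j k (Suc a + e) - c' j k (Suc a + e)) * ?x i ^ e) = 0"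
          by (simp add: left_diff_distrib sum_subtractf del: of_nat_Suc)
      qed
      then show ?thesis using e by simp
    qed
    then show "g = g'" unfolding c(2) c'(2) by presburger
  qed
  fix Y assume "Y \<in> carrier ?H"
  then have Y: "Y i \<in> cut_unipotent l" if "i < gap ns l" for i
    using that by (auto simp: Nc_l_eq[OF l] PiE_iff)
  have Yext: "Y \<in> extensional {..<gap ns l}"
    using \<open>Y \<in> carrier ?H\<close> by (auto simp: PiE_iff)
  define a where "a k = nat (ns ! (l - 1) - N k)" for k
  \<comment> \<open>The prescribed matrices are interpolated entrywise after division by the
    monomial factor at each node.\<close>
  have "\<forall>j k. \<exists>b. \<forall>i<gap ns l. (\<Sum>e<gap ns l. b e * ?x i ^ e) = Y i $$ (j, k) / ?x i ^ Suc (a k)"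
    by (intro allI interpolation_exists[OF xinj])
  then obtain b where b: "\<And>j k i. i < gap ns l \<Longrightarrow>
      (\<Sum>e<gap ns l. b j k e * ?x i ^ e) = Y i $$ (j, k) / ?x i ^ Suc (a k)" by metis
  define c where "c j k e = (if (j, k, e) \<in> window l then b j k (e - Suc (a k)) else 0)" for j k e
  have c: "supp c \<subseteq> window l" by (auto simp: supp_def c_def)
  have "?\<Phi> (unip_aut c) i = Y i" for i
  proof (cases "i < gap ns l")
    case False
    \<comment> \<open>Outside the index set both sides are \<open>undefined\<close>.\<close>
    then show ?thesis using Yext by (simp add: extensional_def)
  next
    case i: True
    have "fst (unip_aut c) (?x i) = Y i"
    proof (rule eq_matI)
      fix j k assume "j < dim_row (Y i)" "k < dim_col (Y i)"
      then have jk: "j < r" "k < r" using cut_unipotent_carrier_mat[OF Y(1)[OF i]] by auto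
      show "fst (unip_aut c) (?x i) $$ (j, k) = Y i $$ (j, k)"
      proof (cases "q k < l \<and> l \<le> q j")
        case False
        then show ?thesis using cut_unipotent_trivial[OF cut_unipotent[OF c] jk] cut_unipotent_trivial[OF Y(1)[OF i] jk] by metis
      next
        case True
        have "q k \<le> l - 1" using True by linarith
        then have "N k \<le> ns ! (l - 1)"
          using l q_less[OF jk(2)] by (simp add: N_exp_def ns_le_iff)
        then have "c j k (Suc (a k) + e) = b j k e" if "e < gap ns l" for e
          using that jk True gap_pos[OF l] by (auto simp: c_def window_def a_def)
        then have "(\<Sum>e<gap ns l. c j k (Suc (a k) + e) * ?x i ^ e) = Y i $$ (j, k) / ?x i ^ Suc (a k)"
          by (subst b[OF i, symmetric]) (intro sum.cong, auto)
        moreover have "j \<noteq> k" using True by auto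
        ultimately show ?thesis
          using fst_unip_aut_index[OF jk] window_sum[OF l c jk, of "?x i"] True x0[of i]
          by (simp add: a_def del: of_nat_Suc power_Suc)
      qed
    qed (use cut_unipotent_carrier_mat[OF Y(1)[OF i]] in auto)
    then show ?thesis using i by simp
  qed
  then have "?\<Phi> (unip_aut c) = Y" by blast
  then show "\<exists>g\<in>carrier ?G. ?\<Phi> g = Y" using c by (auto simp: unip_auts_def)
qed

section \<open>Two summands\<close>

text \<open>For two blocks all unipotent matrices multiply additively, so an automorphism with
  unipotent value at the origin amounts to its \<open>gap ns 1 + 1\<close> coefficient matrices. The
  factors N_N record coefficients here, and D_N is split off from their product.\<close>

lemma two_summands_semidirect:
  assumes s2: "s = 2"
  defines "K \<equiv> product_group {..<gap ns 1 + 1} (\<lambda>_. GL r\<lparr>carrier := NN ms\<rparr>)"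
  shows "\<exists>\<phi> h. \<phi> \<in> hom (GL r\<lparr>carrier := DN ms\<rparr>) (AutoGroup K) \<and>
    h \<in> iso (semidirect K (GL r\<lparr>carrier := DN ms\<rparr>) \<phi>) Aut \<and>
    (\<forall>D\<in>DN ms. h (\<one>\<^bsub>K\<^esub>, D) = \<iota> D)"
proof -
  let ?d = "gap ns 1" and ?D = "GL r\<lparr>carrier := DN ms\<rparr>"
  define cut where "cut j k \<longleftrightarrow> j < r \<and> k < r \<and> q k < 1 \<and> 1 \<le> q j" for j k
  \<comment> \<open>Only the lower left block of \<open>A e\<close> carries information; it becomes
    the coefficient of z^e.\<close>
  define coef :: "(nat \<Rightarrow> complex mat) \<Rightarrow> nat \<Rightarrow> nat \<Rightarrow> nat \<Rightarrow> complex" where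
    "coef A j k e = (if cut j k \<and> e \<le> ?d then A e $$ (j, k) else 0)" for A j k e
  define f where "f A = unip_aut (coef A)" for A
  have cutN: "N j - N k = int ?d" if "cut j k" for j k
  proof -
    have "q j = 1" "q k = 0" using that q_less[of j] s2 by (auto simp: cut_def)
    then show ?thesis using gap_pos[of 1] s2 by (simp add: N_exp_def)
  qed
  have supp: "supp (coef A) \<subseteq> exponents" for A
  proof
    fix x assume "x \<in> supp (coef A)"
    then obtain j k e where x: "x = (j, k, e)" "cut j k" "e \<le> ?d"
      by (auto simp: supp_def coef_def split: if_splits)
    then show "x \<in> exponents" using cutN[of j k] by (auto simp: exponents_def cut_def)
  qed
  have NN: "A \<in> NN ms \<longleftrightarrow> A \<in> cut_unipotent 1" for A by (simp add: NN_eq_cut_unipotent[OF s2])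
  have K: "A \<in> carrier K \<longleftrightarrow> A \<in> {..<?d + 1} \<rightarrow>\<^sub>E NN ms" for A by (simp add: K_def)
  \<comment> \<open>The factor with exponent 0 is the value at the origin; it gives invertibility
    and the comparison with D_N.\<close>
  have f0: "fst (f A) 0 = A 0" if A: "A \<in> carrier K" for A
  proof (rule eq_matI)
    have A0: "A 0 \<in> cut_unipotent 1" using A unfolding K NN[symmetric] by (auto simp: PiE_iff)
    show "dim_row (fst (f A) 0) = dim_row (A 0)" "dim_col (fst (f A) 0) = dim_col (A 0)"
      using cut_unipotent_carrier_mat[OF A0] by (auto simp: f_def)
    fix j k assume "j < dim_row (A 0)" "k < dim_col (A 0)"
    then have jk: "j < r" "k < r" using cut_unipotent_carrier_mat[OF A0] by auto
    show "fst (f A) 0 $$ (j, k) = A 0 $$ (j, k)"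
    proof (cases "cut j k")
      case True
      then have "j \<noteq> k" by (auto simp: cut_def)
      with True show ?thesis unfolding f_def fst_unip_aut_0[OF jk] by (simp add: coef_def)
    next
      case False
      then show ?thesis unfolding f_def fst_unip_aut_0[OF jk]
        using cut_unipotent_trivial[OF A0 jk] jk by (auto simp: coef_def cut_def)
    qed
  qed
  have f_closed: "f A \<in> carrier Aut" if A: "A \<in> carrier K" for A
  proof -
    have "A 0 \<in> carrier (GL r)" using A by (auto simp: K PiE_iff NN_def)
    then show ?thesis
      using f0[OF A] unip_aut_End_E[OF supp] by (simp add: mem_Aut_iff carrier_GL f_def)
  qed
  have f_hom: "f \<in> hom K Aut"
  proof (rule homI)
    fix A B assume AB: "A \<in> carrier K" "B \<in> carrier K"
    have "coef (A \<otimes>\<^bsub>K\<^esub> B) j k e = coef A j k e + coef B j k e" for j k e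
    proof (cases "cut j k \<and> e \<le> ?d")
      case True
      then have "A e \<in> cut_unipotent 1" "B e \<in> cut_unipotent 1" using AB unfolding K NN[symmetric] by (auto simp: PiE_iff)
      then have "(A e * B e) $$ (j, k) = A e $$ (j, k) + B e $$ (j, k)"
        using True cut_unipotent_mult_index[of "A e" 1 "B e" j k] by (auto simp: cut_def)
      with True show ?thesis by (simp add: coef_def K_def)
    qed (auto simp: coef_def)
    then have "coef (A \<otimes>\<^bsub>K\<^esub> B) = (\<lambda>j k e. coef A j k e + coef B j k e)" by blast
    moreover have "f A \<otimes>\<^bsub>Aut\<^esub> f B = unip_aut (\<lambda>j k e. coef A j k e + coef B j k e)"
      unfolding f_def by (rule unip_aut_mult[where l = 1, OF supp supp])
        (auto simp: coef_def cut_def split: if_splits)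
    ultimately show "f (A \<otimes>\<^bsub>K\<^esub> B) = f A \<otimes>\<^bsub>Aut\<^esub> f B" by (simp add: f_def)
  qed (rule f_closed)
  have f_inj: "inj_on f (carrier K)"
  proof (rule inj_onI)
    fix A B assume AB: "A \<in> carrier K" "B \<in> carrier K" and eq: "f A = f B"
    have "A e = B e" if e: "e \<in> {..<?d + 1}" for e
    proof (rule eq_matI)
      have ABe: "A e \<in> cut_unipotent 1" "B e \<in> cut_unipotent 1" using AB e unfolding K NN[symmetric] by (auto simp: PiE_iff)
      show "dim_row (A e) = dim_row (B e)" "dim_col (A e) = dim_col (B e)"
        using cut_unipotent_carrier_mat[OF ABe(1)] cut_unipotent_carrier_mat[OF ABe(2)] by auto
      fix j k assume "j < dim_row (B e)" "k < dim_col (B e)"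
      then have jk: "j < r" "k < r" using cut_unipotent_carrier_mat[OF ABe(2)] by auto
      show "A e $$ (j, k) = B e $$ (j, k)"
      proof (cases "cut j k")
        case True
        have "(\<Sum>i\<le>?d. (coef A j k i - coef B j k i) * z ^ i) = 0" for z
        proof -
          have "fst (f A) z $$ (j, k) = fst (f B) z $$ (j, k)" by (simp add: eq)
          then show ?thesis
            unfolding f_def fst_unip_aut_index[OF jk] by (simp add: cutN[OF True] left_diff_distrib sum_subtractf)
        qed
        then have "\<forall>i. i \<le> ?d \<longrightarrow> coef A j k i - coef B j k i = 0"
          using polyfun_eq_0[of "\<lambda>i. coef A j k i - coef B j k i" ?d] by blast
        with e True show ?thesis by (simp add: coef_def)
      next
        case False
        then show ?thesis using cut_unipotent_trivial[OF ABe(1) jk] cut_unipotent_trivial[OF ABe(2) jk] jk by (simp add: cut_def)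
      qed
    qed
    then show "A = B" using AB unfolding K by (intro PiE_ext) auto
  qed
  \<comment> \<open>A unipotent value at the origin suffices for membership in the image of
    \<open>f\<close>. The normalisation condition and surjectivity are both reduced to this.\<close>
  have image: "g \<in> f ` carrier K" if g: "g \<in> carrier Aut" "fst g 0 \<in> NN ms" for g
  proof -
    have "\<exists>c. supp c \<subseteq> exponents \<and> g = unip_aut c"
      using g by (intro End_E_eq_unip_aut) (auto simp: Aut_End_E NN_def)
    then obtain c where c: "supp c \<subseteq> exponents" "g = unip_aut c" by blast
    have c0: "c j k e = 0" if "\<not> (cut j k \<and> e \<le> ?d)" for j k e
    proof (rule supp_zero[OF c(1)], rule notI)
      assume "(j, k, e) \<in> exponents"
      then have *: "j < r" "k < r" "q k < q j" "int e \<le> N j - N k" by (auto simp: exponents_def)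
      then have "cut j k" using q_less[of j] s2 by (auto simp: cut_def)
      with * that cutN[of j k] show False by auto
    qed
    define A where "A = (\<lambda>e\<in>{..<?d + 1}. Matrix.mat r r (\<lambda>(j, k). (if j = k then 1 else 0) + c j k e))"
    have "A e \<in> cut_unipotent 1" if "e < ?d + 1" for e
      by (rule mem_cut_unipotent_I) (use that c0 in \<open>auto simp: A_def cut_def\<close>)
    then have A: "A \<in> carrier K" unfolding K NN_eq_cut_unipotent[OF s2] by (auto simp: A_def PiE_iff)
    have "coef A j k e = c j k e" for j k e
    proof (cases "cut j k \<and> e \<le> ?d")
      case True
      then have "j \<noteq> k" by (auto simp: cut_def)
      with True show ?thesis by (auto simp: coef_def A_def cut_def)
    next
      case False
      then show ?thesis using c0[of j k e] by (auto simp: coef_def)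
    qed
    then have "coef A = c" by blast
    with A c(2) show ?thesis by (auto simp: f_def)
  qed
  interpret c: group_hom parabolic_group Aut \<iota> by (rule const_hom)
  have cD: "\<iota> D \<in> carrier Aut" if "D \<in> DN ms" for D
    using that const_aut_closed DN_parabolic by blast
  have c_hom: "\<iota> \<in> hom ?D Aut" using c.homh DN_parabolic by (auto simp: hom_def)
  have one: "\<iota> (1\<^sub>m r) = \<one>\<^bsub>Aut\<^esub>" using c.hom_one by simp
  have grpK: "group K" unfolding K_def by (rule product_group) (rule group_NN)
  have "\<exists>\<phi>. \<phi> \<in> hom ?D (AutoGroup K) \<and> (\<lambda>(k, D). f k \<otimes>\<^bsub>Aut\<^esub> \<iota> D) \<in> hom (semidirect K ?D \<phi>) Aut \<and>
    inj_on (\<lambda>(k, D). f k \<otimes>\<^bsub>Aut\<^esub> \<iota> D) (carrier K \<times> carrier ?D)"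
  proof (rule Aut.internal_semidirect[OF grpK group_DN f_hom f_inj c_hom])
    show "inj_on \<iota> (carrier ?D)" by (auto simp: inj_on_def dest: const_aut_inj)
    fix A D assume A: "A \<in> carrier K" and "D \<in> carrier ?D"
    then have D: "D \<in> DN ms" by simp
    have A0: "A 0 \<in> NN ms" using A unfolding K by (auto simp: PiE_iff)
    \<comment> \<open>Conjugation by \<open>D\<close> keeps the value at the origin in N_N.\<close>
    let ?g = "\<iota> D \<otimes>\<^bsub>Aut\<^esub> f A \<otimes>\<^bsub>Aut\<^esub> inv\<^bsub>Aut\<^esub> \<iota> D"
    have "inv\<^bsub>Aut\<^esub> \<iota> D = \<iota> (inv\<^bsub>parabolic_group\<^esub> D)" using c.hom_inv[of D] DN_parabolic[OF D] by simp
    then have "fst ?g 0 = D \<otimes>\<^bsub>parabolic_group\<^esub> A 0 \<otimes>\<^bsub>parabolic_group\<^esub> inv\<^bsub>parabolic_group\<^esub> D" by (simp add: f0[OF A])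
    then have "fst ?g 0 \<in> NN ms" using DN_normalises_NN[OF A0 D] by simp
    then show "?g \<in> f ` carrier K" using f_closed[OF A] cD[OF D] by (intro image) simp_all
    assume "f A = \<iota> D"
    then have "A 0 = D" using f0[OF A] by simp
    with A0 D have "D = 1\<^sub>m r" using NN_Int_DN by blast
    then show "\<iota> D = \<one>\<^bsub>Aut\<^esub>" by (simp add: one)
  qed
  then obtain \<phi> where \<phi>: "\<phi> \<in> hom ?D (AutoGroup K)"
    and hom: "(\<lambda>(k, D). f k \<otimes>\<^bsub>Aut\<^esub> \<iota> D) \<in> hom (semidirect K ?D \<phi>) Aut"
    and inj: "inj_on (\<lambda>(k, D). f k \<otimes>\<^bsub>Aut\<^esub> \<iota> D) (carrier K \<times> carrier ?D)" by blast
  let ?h = "\<lambda>(k, D). f k \<otimes>\<^bsub>Aut\<^esub> \<iota> D"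
  have "?h \<in> iso (semidirect K ?D \<phi>) Aut"
  proof (rule isoI_inj_surj[OF hom])
    fix g assume g: "g \<in> carrier Aut"
    obtain U D where UD: "U \<in> NN ms" "D \<in> DN ms" "fst g 0 = U * D"
      using parabolic_factor fst_parabolic[OF g] by blast
    have parabolic: "U \<in> carrier parabolic_group" "D \<in> carrier parabolic_group" using UD NN_parabolic DN_parabolic by auto
    \<comment> \<open>Dividing by the block-diagonal factor leaves the value \<open>U\<close> at the
      origin.\<close>
    let ?p = "g \<otimes>\<^bsub>Aut\<^esub> inv\<^bsub>Aut\<^esub> \<iota> D"
    have "inv\<^bsub>Aut\<^esub> \<iota> D = \<iota> (inv\<^bsub>parabolic_group\<^esub> D)" using c.hom_inv[OF parabolic(2)] by simp
    then have "fst ?p 0 = U \<otimes>\<^bsub>parabolic_group\<^esub> D \<otimes>\<^bsub>parabolic_group\<^esub> inv\<^bsub>parabolic_group\<^esub> D" by (simp add: UD)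
    also have "\<dots> = U"
      using parabolic c.G.m_assoc c.G.inv_closed c.G.r_inv c.G.r_one by metis
    finally have "?p \<in> f ` carrier K" using g UD cD by (intro image) simp_all
    then obtain A where A: "A \<in> carrier K" "?p = f A" by blast
    have "?h (A, D) = g" using g cD[OF UD(2)] by (simp flip: A(2) add: Aut.m_assoc)
    with A UD show "\<exists>x\<in>carrier (semidirect K ?D \<phi>). ?h x = g"
      by (intro bexI[of _ "(A, D)"]) auto
  qed (use inj in simp)
  moreover have "?h (\<one>\<^bsub>K\<^esub>, D) = \<iota> D" if "D \<in> DN ms" for D
    using hom_one[OF f_hom grpK group_Aut] cD[OF that] by simp
  ultimately show ?thesis using \<phi> by blast
qed

end

section \<open>Assembly of the cases s > 2 and s = 2\<close>

theorem theorem1: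
  fixes s :: nat and ns :: "int list" and ms :: "nat list"
  assumes "s \<ge> 2"
    and "length ns = s" and "sorted_wrt (<) ns"
    and "length ms = s" and "\<forall>m\<in>set ms. m > 0"
  shows
    "(s > 2 \<longrightarrow>
       (\<exists>G :: nat \<Rightarrow> bundle_aut set. \<exists>P.
          (\<forall>l\<in>{1..<s}. subgroup (G l) (Aut_E ns ms)) \<and>
          P = set_mult_list (Aut_E ns ms) (map G [1..<s]) \<and>
          subgroup P (Aut_E ns ms) \<and>
          (\<exists>\<phi> \<psi>.
             \<phi> \<in> hom (GL (sum_list ms)\<lparr>carrier := NN ms\<rparr>)
                      (AutoGroup (Aut_E ns ms\<lparr>carrier := P\<rparr>)) \<and>
             \<psi> \<in> hom (GL (sum_list ms)\<lparr>carrier := DN ms\<rparr>)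
                      (AutoGroup (semidirect (Aut_E ns ms\<lparr>carrier := P\<rparr>)
                                             (GL (sum_list ms)\<lparr>carrier := NN ms\<rparr>) \<phi>)) \<and>
             (\<lambda>((p, A), D). p \<otimes>\<^bsub>Aut_E ns ms\<^esub> const_aut ns ms A \<otimes>\<^bsub>Aut_E ns ms\<^esub> const_aut ns ms D)
               \<in> iso (semidirect
                        (semidirect (Aut_E ns ms\<lparr>carrier := P\<rparr>)
                                    (GL (sum_list ms)\<lparr>carrier := NN ms\<rparr>) \<phi>)
                        (GL (sum_list ms)\<lparr>carrier := DN ms\<rparr>) \<psi>)
                     (Aut_E ns ms)) \<and>
          (\<forall>l\<in>{1..<s}. \<exists>pt :: nat \<Rightarrow> cp1.
             inj_on pt {..<gap ns l} \<and>
             (\<lambda>g. \<lambda>i\<in>{..<gap ns l}. fiber_restr (pt i) g)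
               \<in> iso (Aut_E ns ms\<lparr>carrier := G l\<rparr>)
                     (product_group {..<gap ns l}
                        (\<lambda>_. GL (sum_list ms)\<lparr>carrier := Nc_l ms l\<rparr>))))) \<and>
     (s = 2 \<longrightarrow>
       (\<exists>\<phi> h.
          \<phi> \<in> hom (GL (sum_list ms)\<lparr>carrier := DN ms\<rparr>)
                   (AutoGroup (product_group {..<gap ns 1 + 1}
                                 (\<lambda>_. GL (sum_list ms)\<lparr>carrier := NN ms\<rparr>))) \<and>
          h \<in> iso (semidirect
                     (product_group {..<gap ns 1 + 1}
                        (\<lambda>_. GL (sum_list ms)\<lparr>carrier := NN ms\<rparr>))
                     (GL (sum_list ms)\<lparr>carrier := DN ms\<rparr>) \<phi>)
                  (Aut_E ns ms) \<and>
          (\<forall>D\<in>DN ms.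
             h (\<one>\<^bsub>product_group {..<gap ns 1 + 1}
                       (\<lambda>_. GL (sum_list ms)\<lparr>carrier := NN ms\<rparr>)\<^esub>, D)
             = const_aut ns ms D)))"
proof -
  interpret split_bundle s ns ms by unfold_locales (use assms in auto)
  let ?G = "\<lambda>l. unip_auts (window l)"
  have sub: "\<forall>l\<in>{1..<s}. subgroup (?G l) Aut" using subgroup_cut_subgroup by auto
  have fib: "\<forall>l\<in>{1..<s}. \<exists>pt :: nat \<Rightarrow> cp1. inj_on pt {..<gap ns l} \<and>
      (\<lambda>g. \<lambda>i\<in>{..<gap ns l}. fiber_restr (pt i) g)
        \<in> iso (Aut\<lparr>carrier := ?G l\<rparr>) (product_group {..<gap ns l} (\<lambda>_. GL r\<lparr>carrier := Nc_l ms l\<rparr>))"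
  proof
    fix l assume "l \<in> {1..<s}"
    then show "\<exists>pt :: nat \<Rightarrow> cp1. inj_on pt {..<gap ns l} \<and>
      (\<lambda>g. \<lambda>i\<in>{..<gap ns l}. fiber_restr (pt i) g)
        \<in> iso (Aut\<lparr>carrier := ?G l\<rparr>) (product_group {..<gap ns l} (\<lambda>_. GL r\<lparr>carrier := Nc_l ms l\<rparr>))"
      by (intro exI[of _ "\<lambda>i. Affine (of_nat (Suc i))"] conjI fiber_iso) (auto simp: inj_on_def)
  qed
  \<comment> \<open>The product set of the G_l is \<open>Aut_ker\<close>, which makes it a subgroup
    and lets the splitting by evaluation supply both actions.\<close>
  show ?thesis
    using sub fib set_mult_list_G[symmetric] subgroup_Aut_ker Aut_semidirect two_summands_semidirect
    by (intro conjI impI exI[of _ ?G] exI[of _ Aut_ker]) simp_all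
qed

end
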